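(* Let $X$ be either the Tsirelson space $T$ or the $p^{\text{th}}$ Baernstein space $B_p$, where $1<p<\infty$. Then the Banach algebra $\mathscr{B}(X)$ of bounded linear operators on $X$, regarded as a Banach space with the operator norm, is not a Grothendieck space.
   Context: Scalars are real or complex, and $\mathbb{N}=\{1,2,3,\ldots\}$. A Grothendieck space is a Banach space $Y$ for which every weak*-convergent sequence in the dual space $Y^*$ converges weakly. Let $c_{00}$ denote the vector space of finitely supported scalar sequences indexed by $\mathbb{N}$. For non-empty subsets $M,N$ of $\mathbb{N}$ with $M$ finite, $M<N$ means $\max M<\min N$. A non-empty, finite subset $M$ of $\mathbb{N}$ is (Schreier-)admissible if $|M|\leqslant\min M$. The Tsirelson space $T$ is the dual of the reflexive space originally constructed by Tsirelson, following the convention of Figiel and Johnson. Explicitly, $T$ is the completion of $c_{00}$ with respect to the unique norm satisfying \[ \|x\|_T=\max\Bigl\{\|x\|_\infty,\ \tfrac12\sup\sum_{j=1}^k\|E_jx\|_T\Bigr\}\qquad(x\in c_{00}), \] where the supremum is over all $k\in\mathbb{N}$ and all non-empty finite subsets $E_1<E_2<\cdots<E_k$ of $\mathbb{N}$ with $k\leqslant\min E_1$, and $E_jx$ denotes the sequence that agrees with $x$ on $E_j$ and is zero elsewhere. For $1<p<\infty$, the $p^{\text{th}}$ Baernstein space $B_p$ is the completion of $c_{00}$ with respect to the norm \[ \|x\|_{B_p}=\sup\Bigl\{\Bigl(\sum_{j=1}^k\mu(x,N_j)^p\Bigr)^{1/p} : k\in\mathbb{N},\ N_1<N_2<\cdots<N_k\text{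 admissible subsets of }\mathbb{N}\Bigr\}, \] where $\mu(x,N)=\sum_{n\in N}|\alpha_n|$ for $x=(\alpha_n)_{n=1}^\infty\in c_{00}$ and $N\subseteq\mathbb{N}$. *)

theory Defs
  imports "HOL-Analysis.Analysis"
begin

section \<open>Scalars and Banach spaces over them\<close>

text \<open>The scalar field is the reals or the complex numbers: the field is spanned over the reals
  by 1, or by 1 and a square root of -1. (Multiplicativity of the norm then forces it to be the
  usual modulus.)\<close>

class real_or_complex = real_normed_field +
  assumes real_or_complex:
    "(\<forall>z. \<exists>a. z = a *\<^sub>R 1) \<or> (\<exists>i. i * i = - 1 \<and> (\<forall>z. \<exists>a b. z = a *\<^sub>R 1 + b *\<^sub>R i))"

instance real :: real_or_complex
  by standard auto

instance complex :: real_or_complex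
proof
  have "\<i> * \<i> = - 1 \<and> (\<forall>z. \<exists>a b. z = a *\<^sub>R 1 + b *\<^sub>R \<i>)"
    by (auto simp: complex_eq_iff)
  then show "(\<forall>z::complex. \<exists>a. z = a *\<^sub>R 1) \<or>
      (\<exists>i::complex. i * i = - 1 \<and> (\<forall>z. \<exists>a b. z = a *\<^sub>R 1 + b *\<^sub>R i))"
    by blast
qed

text \<open>The library class \<open>banach\<close> has real scalars only; a Banach space over the scalar field is
  such a space together with a compatible multiplication by scalars.\<close>

locale banach_over = vector_space smul
  for smul :: "'k::real_or_complex \<Rightarrow> 'v::banach \<Rightarrow> 'v" +
  assumes scale_of_real: "smul (of_real r) x = r *\<^sub>R x"
    and norm_scale: "norm (smul a x) = norm a * norm x"

section \<open>Duals and Grothendieck spaces\<close>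

text \<open>Duals and operator spaces depend on the scalar multiplication, hence are not types; they are
  described by an explicit carrier with operations.\<close>

record ('k, 'b) nspace =
  points :: "'b set"
  add :: "'b \<Rightarrow> 'b \<Rightarrow> 'b"
  smult :: "'k \<Rightarrow> 'b \<Rightarrow> 'b"
  nrm :: "'b \<Rightarrow> real"

text \<open>Functionals are normalised to vanish off the carrier, so that equality of functionals is
  equality on the carrier.\<close>

definition dual :: "('k::real_normed_field, 'b) nspace \<Rightarrow> ('k, 'b \<Rightarrow> 'k) nspace" where
  "dual Y = \<lparr>
     points = {f.
       (\<forall>x\<in>points Y. \<forall>y\<in>points Y. f (add Y x y) = f x + f y) \<and>
       (\<forall>a. \<forall>x\<in>points Y. f (smult Y a x) = a * f x) \<and>
       (\<exists>K. \<forall>x\<in>points Y. norm (f x) \<le> K * nrm Y x) \<and>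
       (\<forall>x. x \<notin> points Y \<longrightarrow> f x = 0)},
     add = (\<lambda>f g x. f x + g x),
     smult = (\<lambda>a f x. a * f x),
     nrm = (\<lambda>f. Sup {norm (f x) | x. x \<in> points Y \<and> nrm Y x \<le> 1})\<rparr>"

definition weak_converges :: "('k::real_normed_field, 'b) nspace \<Rightarrow> (nat \<Rightarrow> 'b) \<Rightarrow> 'b \<Rightarrow> bool" where
  "weak_converges Z z l \<longleftrightarrow> (\<forall>\<phi>\<in>points (dual Z). (\<lambda>n. \<phi> (z n)) \<longlonglongrightarrow> \<phi> l)"

definition weak_star_converges ::
  "('k::real_normed_field, 'b) nspace \<Rightarrow> (nat \<Rightarrow> 'b \<Rightarrow> 'k) \<Rightarrow> ('b \<Rightarrow> 'k) \<Rightarrow> bool" where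
  "weak_star_converges Y f g \<longleftrightarrow> (\<forall>y\<in>points Y. (\<lambda>n. f n y) \<longlonglongrightarrow> g y)"

text \<open>To be applied to Banach spaces; completeness is not part of the predicate, so that its
  negation is not satisfied by incompleteness.\<close>

definition grothendieck_space :: "('k::real_normed_field, 'b) nspace \<Rightarrow> bool" where
  "grothendieck_space Y \<longleftrightarrow>
     (\<forall>f. (\<forall>n. f n \<in> points (dual Y)) \<and> (\<exists>g\<in>points (dual Y). weak_star_converges Y f g)
       \<longrightarrow> (\<exists>g\<in>points (dual Y). weak_converges (dual Y) f g))"

text \<open>Bounded operators that are linear over the scalar field, inside the library's type of bounded
  real-linear maps, whose norm is the operator norm.\<close>

definition operator_space ::
  "('k::real_normed_field \<Rightarrow> 'v::real_normed_vector \<Rightarrow> 'v) \<Rightarrow> ('k, 'v \<Rightarrow>\<^sub>L 'v) nspace" where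
  "operator_space smul = \<lparr>
     points = {S. \<forall>a x. blinfun_apply S (smul a x) = smul a (blinfun_apply S x)},
     add = (+),
     smult = (\<lambda>a S. Blinfun (\<lambda>x. smul a (blinfun_apply S x))),
     nrm = norm\<rparr>"

section \<open>Norms on finitely supported sequences\<close>

text \<open>Sequences are indexed by the positive integers; this is encoded by the value 0 at index 0.\<close>

definition c00 :: "(nat \<Rightarrow> 'k::real_normed_field) set" where
  "c00 = {x. finite {n. x n \<noteq> 0} \<and> x 0 = 0}"

definition norm_on_c00 :: "((nat \<Rightarrow> 'k::real_normed_field) \<Rightarrow> real) \<Rightarrow> bool" where
  "norm_on_c00 N \<longleftrightarrow>
     (\<forall>x\<in>c00. 0 \<le> N x \<and> (N x = 0 \<longleftrightarrow> x = (\<lambda>n. 0))) \<and>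
     (\<forall>a. \<forall>x\<in>c00. N (\<lambda>n. a * x n) = norm a * N x) \<and>
     (\<forall>x\<in>c00. \<forall>y\<in>c00. N (\<lambda>n. x n + y n) \<le> N x + N y)"

definition is_c00_completion ::
  "((nat \<Rightarrow> 'k::real_normed_field) \<Rightarrow> real) \<Rightarrow> ('k \<Rightarrow> 'v::banach \<Rightarrow> 'v) \<Rightarrow> bool" where
  "is_c00_completion N smul \<longleftrightarrow> (\<exists>\<iota>.
     (\<forall>x\<in>c00. \<forall>y\<in>c00. \<iota> (\<lambda>n. x n + y n) = \<iota> x + \<iota> y) \<and>
     (\<forall>a. \<forall>x\<in>c00. \<iota> (\<lambda>n. a * x n) = smul a (\<iota> x)) \<and>
     (\<forall>x\<in>c00. norm (\<iota> x) = N x) \<and>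
     closure (\<iota> ` c00) = UNIV)"

text \<open>\<open>successive k E\<close>: \<open>E 1 < E 2 < \<dots> < E k\<close> are non-empty finite sets of positive integers.\<close>

definition successive :: "nat \<Rightarrow> (nat \<Rightarrow> nat set) \<Rightarrow> bool" where
  "successive k E \<longleftrightarrow>
     (\<forall>j\<in>{1..k}. finite (E j) \<and> E j \<noteq> {} \<and> 0 \<notin> E j) \<and>
     (\<forall>j. 1 \<le> j \<and> j < k \<longrightarrow> Max (E j) < Min (E (Suc j)))"

definition restr :: "nat set \<Rightarrow> (nat \<Rightarrow> 'k::zero) \<Rightarrow> nat \<Rightarrow> 'k" where
  "restr A x = (\<lambda>n. if n \<in> A then x n else 0)"

subsection \<open>The Tsirelson norm\<close>

definition tsirelson_sums ::
  "((nat \<Rightarrow> 'k::real_normed_field) \<Rightarrow> real) \<Rightarrow> (nat \<Rightarrow> 'k) \<Rightarrow> real set" where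
  "tsirelson_sums N x =
     {(\<Sum>j=1..k. N (restr (E j) x)) | k E. 1 \<le> k \<and> successive k E \<and> k \<le> Min (E 1)}"

text \<open>The condition off \<open>c00\<close> only makes \<open>N\<close> unique as a total function.\<close>

definition is_tsirelson_norm :: "((nat \<Rightarrow> 'k::real_normed_field) \<Rightarrow> real) \<Rightarrow> bool" where
  "is_tsirelson_norm N \<longleftrightarrow>
     norm_on_c00 N \<and> (\<forall>x. x \<notin> c00 \<longrightarrow> N x = 0) \<and>
     (\<forall>x\<in>c00. N x = max (SUP n. norm (x n)) (1/2 * Sup (tsirelson_sums N x)))"

definition tsirelson_norm :: "(nat \<Rightarrow> 'k::real_normed_field) \<Rightarrow> real" where
  "tsirelson_norm = (THE N. is_tsirelson_norm N)"

text \<open>Existence (as the limit of an iteration starting from the supremum norm) and uniqueness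
  (by induction on the size of the support) of the norm in this definition.\<close>

lemma restr_c00: "restr A x \<in> c00" if "x \<in> c00"
proof -
  have "{n. restr A x n \<noteq> 0} \<subseteq> {n. x n \<noteq> 0}" by (auto simp: restr_def)
  then have "finite {n. restr A x n \<noteq> 0}"
    using that finite_subset by (auto simp: c00_def)
  then show ?thesis using that by (simp add: c00_def restr_def)
qed

lemma successive_less:
  assumes "successive k E" "1 \<le> i" "i < j" "j \<le> k" "a \<in> E i" "b \<in> E j"
  shows "a < b"
  using assms(3,4,6)
proof (induction j arbitrary: b)
  case 0
  then show ?case by simp
next
  case (Suc j)
  have fin: "finite (E l) \<and> E l \<noteq> {}" if "1 \<le> l" "l \<le> k" for l
    using assms(1) that by (auto simp: successive_def)
  have step: "Max (E j) < b"
  proof -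
    have "Max (E j) < Min (E (Suc j))"
      using assms(1,2) Suc.prems unfolding successive_def
      by (metis Suc_le_eq le_less_trans less_Suc_eq_le order_trans)
    also have "\<dots> \<le> b" using fin[of "Suc j"] Suc.prems by simp
    finally show ?thesis .
  qed
  show ?case
  proof (cases "i = j")
    case True
    then have "a \<le> Max (E j)" using fin[of j] assms(2,5) Suc.prems by simp
    then show ?thesis using step by simp
  next
    case False
    then have "a < Max (E j)"
      using Suc.IH[of "Max (E j)"] fin[of j] assms(2) Suc.prems by simp
    then show ?thesis using step by simp
  qed
qed

lemma successive_disjoint:
  assumes "successive k E" "i \<in> {1..k}" "j \<in> {1..k}" "i \<noteq> j"
  shows "E i \<inter> E j = {}"
proof (cases "i < j")
  case True
  then show ?thesis using successive_less[OF assms(1), of i j] assms(2,3) by fastforce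
next
  case False
  then show ?thesis using successive_less[OF assms(1), of j i] assms(2,3,4) by fastforce
qed

lemma tsirelson_sums_nonempty: "tsirelson_sums N x \<noteq> {}"
proof -
  have "successive 1 (\<lambda>_. {1})" by (auto simp: successive_def)
  then show ?thesis unfolding tsirelson_sums_def by (force intro!: exI[of _ "1::nat"] exI[of _ "\<lambda>_. {1}"])
qed

lemma sum_coordinates_le:
  fixes x :: "nat \<Rightarrow> 'k::real_normed_field"
  assumes E: "successive k E" and x: "x \<in> c00"
    and w0: "\<And>n. 0 \<le> w n" and w: "\<And>n. x n = 0 \<Longrightarrow> w n = (0::real)"
  shows "(\<Sum>j=1..k. \<Sum>n\<in>E j. w n) \<le> (\<Sum>n | x n \<noteq> 0. w n)"
proof -
  have "(\<Sum>j=1..k. \<Sum>n\<in>E j. w n) = (\<Sum>n\<in>(\<Union>j\<in>{1..k}. E j). w n)"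
    using E successive_disjoint[OF E]
    by (subst sum.UNION_disjoint) (auto simp: successive_def)
  also have "\<dots> = (\<Sum>n\<in>(\<Union>j\<in>{1..k}. E j) \<inter> {n. x n \<noteq> 0}. w n)"
    using E w by (intro sum.mono_neutral_right) (auto simp: successive_def)
  also have "\<dots> \<le> (\<Sum>n | x n \<noteq> 0. w n)"
    using x w0 by (intro sum_mono2) (auto simp: c00_def)
  finally show ?thesis .
qed

lemma norm_restr_le:
  assumes N: "norm_on_c00 N" and x: "x \<in> c00" and A: "finite A"
  shows "N (restr A x) \<le> (\<Sum>n\<in>A. N (restr {n} x))"
  using A
proof induction
  case empty
  have "restr {} x = (\<lambda>n. 0)" by (auto simp: restr_def)
  then show ?case using N restr_c00[OF x, of "{}"] by (auto simp: norm_on_c00_def)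
next
  case (insert a A)
  have "restr (insert a A) x = (\<lambda>n. restr {a} x n + restr A x n)"
    using insert by (auto simp: restr_def)
  then have "N (restr (insert a A) x) \<le> N (restr {a} x) + N (restr A x)"
    using N restr_c00[OF x] by (auto simp: norm_on_c00_def)
  then show ?case using insert by simp
qed

lemma zero_c00: "(\<lambda>n. 0) \<in> c00"
  by (simp add: c00_def)

lemma tsirelson_sums_bdd:
  assumes N: "norm_on_c00 N" and x: "x \<in> c00"
  shows "bdd_above (tsirelson_sums N x)"
proof (rule bdd_aboveI)
  fix s assume "s \<in> tsirelson_sums N x"
  then obtain k E where E: "successive k E" and s: "s = (\<Sum>j=1..k. N (restr (E j) x))"
    by (auto simp: tsirelson_sums_def)
  have "s \<le> (\<Sum>j=1..k. \<Sum>n\<in>E j. N (restr {n} x))"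
    unfolding s using E by (intro sum_mono norm_restr_le[OF N x]) (auto simp: successive_def)
  also have "\<dots> \<le> (\<Sum>n | x n \<noteq> 0. N (restr {n} x))"
  proof (rule sum_coordinates_le[OF E x])
    show "0 \<le> N (restr {n} x)" for n
      using N restr_c00[OF x] by (auto simp: norm_on_c00_def)
    show "N (restr {n} x) = 0" if "x n = 0" for n
    proof -
      have "restr {n} x = (\<lambda>n. 0)" using that by (auto simp: restr_def)
      then show ?thesis using N zero_c00 by (auto simp: norm_on_c00_def)
    qed
  qed
  finally show "s \<le> (\<Sum>n | x n \<noteq> 0. N (restr {n} x))" .
qed

lemma sup_norm_bdd:
  assumes "x \<in> c00" shows "bdd_above (range (\<lambda>n. norm (x n :: 'k::real_normed_field)))"
proof -
  have "range (\<lambda>n. norm (x n)) \<subseteq> insert 0 ((\<lambda>n. norm (x n)) ` {n. x n \<noteq> 0})" by auto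
  moreover have "bdd_above (insert 0 ((\<lambda>n. norm (x n)) ` {n. x n \<noteq> 0}))"
    using assms by (auto simp: c00_def)
  ultimately show ?thesis by (rule bdd_above_mono[rotated])
qed

lemma sup_norm_ge: "x \<in> c00 \<Longrightarrow> norm (x n) \<le> (SUP n. norm (x n :: 'k::real_normed_field))"
  by (intro cSUP_upper sup_norm_bdd) auto

lemma add_c00:
  assumes "x \<in> c00" "y \<in> c00" shows "(\<lambda>n. x n + y n) \<in> c00"
proof -
  have "{n. x n + y n \<noteq> 0} \<subseteq> {n. x n \<noteq> 0} \<union> {n. y n \<noteq> 0}" by auto
  then show ?thesis using assms by (auto simp: c00_def dest: finite_subset)
qed

lemma scale_c00:
  assumes "x \<in> c00" shows "(\<lambda>n. a * x n) \<in> c00"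
proof -
  have "{n. a * x n \<noteq> 0} \<subseteq> {n. x n \<noteq> 0}" by auto
  then show ?thesis using assms by (auto simp: c00_def dest: finite_subset)
qed

lemma sup_norm: "norm_on_c00 (\<lambda>x. SUP n. norm (x n :: 'k::real_normed_field))"
  unfolding norm_on_c00_def
proof (intro conjI ballI allI)
  fix x :: "nat \<Rightarrow> 'k" assume x: "x \<in> c00"
  show ge: "0 \<le> (SUP n. norm (x n))"
    using sup_norm_ge[OF x, of 0] norm_ge_zero order_trans by blast
  show "((SUP n. norm (x n)) = 0) = (x = (\<lambda>n. 0))"
    using sup_norm_ge[OF x] by fastforce
  fix a :: 'k
  show "(SUP n. norm (a * x n)) = norm a * (SUP n. norm (x n))"
  proof (cases "a = 0")
    case False
    show ?thesis
    proof (rule antisym)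
      show "(SUP n. norm (a * x n)) \<le> norm a * (SUP n. norm (x n))"
        by (rule cSUP_least) (auto simp: norm_mult intro!: mult_left_mono sup_norm_ge[OF x])
      have "(SUP n. norm (x n)) \<le> (SUP n. norm (a * x n)) / norm a"
      proof (rule cSUP_least)
        show "norm (x n) \<le> (SUP n. norm (a * x n)) / norm a" for n
          using sup_norm_ge[OF scale_c00[OF x], of a n] False
          by (simp add: norm_mult field_simps)
      qed auto
      then show "norm a * (SUP n. norm (x n)) \<le> (SUP n. norm (a * x n))"
        using False by (simp add: field_simps)
    qed
  qed auto
next
  fix x y :: "nat \<Rightarrow> 'k" assume x: "x \<in> c00" and y: "y \<in> c00"
  show "(SUP n. norm (x n + y n)) \<le> (SUP n. norm (x n)) + (SUP n. norm (y n))"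
    by (rule cSUP_least)
       (auto intro: order_trans[OF norm_triangle_ineq] add_mono sup_norm_ge[OF x] sup_norm_ge[OF y])
qed

definition tsirelson_step :: "((nat \<Rightarrow> 'k::real_normed_field) \<Rightarrow> real) \<Rightarrow> (nat \<Rightarrow> 'k) \<Rightarrow> real" where
  "tsirelson_step N x = max (SUP n. norm (x n)) (1/2 * Sup (tsirelson_sums N x))"

lemma tsirelson_step_le_iff:
  assumes "norm_on_c00 N" "x \<in> c00"
  shows "tsirelson_step N x \<le> c \<longleftrightarrow>
    (SUP n. norm (x n)) \<le> c \<and> (\<forall>s\<in>tsirelson_sums N x. 1/2 * s \<le> c)"
proof -
  have "Sup (tsirelson_sums N x) \<le> 2 * c \<longleftrightarrow> (\<forall>s\<in>tsirelson_sums N x. s \<le> 2 * c)"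
    by (rule cSup_le_iff[OF tsirelson_sums_nonempty tsirelson_sums_bdd[OF assms]])
  then show ?thesis by (auto simp: tsirelson_step_def)
qed

lemma tsirelson_step_norm:
  fixes N :: "(nat \<Rightarrow> 'k::real_normed_field) \<Rightarrow> real"
  assumes N: "norm_on_c00 N"
  shows "norm_on_c00 (tsirelson_step N)"
proof -
  have scale_le: "tsirelson_step N (\<lambda>n. a * x n) \<le> norm a * tsirelson_step N x"
    if x: "x \<in> c00" for a and x :: "nat \<Rightarrow> 'k"
    unfolding tsirelson_step_le_iff[OF N scale_c00[OF x]]
  proof (intro conjI ballI)
    have "(SUP n. norm (a * x n)) = norm a * (SUP n. norm (x n))"
      using sup_norm x by (auto simp: norm_on_c00_def)
    also have "\<dots> \<le> norm a * tsirelson_step N x"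
      by (intro mult_left_mono) (auto simp: tsirelson_step_def)
    finally show "(SUP n. norm (a * x n)) \<le> norm a * tsirelson_step N x" .
    fix s assume "s \<in> tsirelson_sums N (\<lambda>n. a * x n)"
    then obtain k E where E: "1 \<le> k" "successive k E" "k \<le> Min (E 1)"
      and s: "s = (\<Sum>j=1..k. N (restr (E j) (\<lambda>n. a * x n)))"
      by (auto simp: tsirelson_sums_def)
    have "restr (E j) (\<lambda>n. a * x n) = (\<lambda>n. a * restr (E j) x n)" for j
      by (auto simp: restr_def)
    then have "s = norm a * (\<Sum>j=1..k. N (restr (E j) x))"
      unfolding s using N restr_c00[OF x] by (auto simp: norm_on_c00_def sum_distrib_left)
    moreover have "1/2 * (\<Sum>j=1..k. N (restr (E j) x)) \<le> tsirelson_step N x"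
    proof -
      have "(\<Sum>j=1..k. N (restr (E j) x)) \<in> tsirelson_sums N x"
        using E by (auto simp: tsirelson_sums_def)
      then show ?thesis using tsirelson_step_le_iff[OF N x, of "tsirelson_step N x"] by auto
    qed
    ultimately show "1/2 * s \<le> norm a * tsirelson_step N x"
      using mult_left_mono[of _ _ "norm a"] by fastforce
  qed
  have ge: "(SUP n. norm (x n)) \<le> tsirelson_step N x" for x
    by (simp add: tsirelson_step_def)
  have sup0: "0 \<le> (SUP n. norm (x n))" if "x \<in> c00" for x :: "nat \<Rightarrow> 'k"
    using sup_norm that by (auto simp: norm_on_c00_def)
  show ?thesis
    unfolding norm_on_c00_def
  proof (intro conjI ballI allI)
    fix x :: "nat \<Rightarrow> 'k" assume x: "x \<in> c00"
    show nn: "0 \<le> tsirelson_step N x"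
      using ge sup0[OF x] order_trans by blast
    show "(tsirelson_step N x = 0) = (x = (\<lambda>n. 0))"
    proof
      assume "tsirelson_step N x = 0"
      then have "(SUP n. norm (x n)) = 0" using ge[of x] sup0[OF x] by simp
      then show "x = (\<lambda>n. 0)" using sup_norm x by (auto simp: norm_on_c00_def)
    next
      assume "x = (\<lambda>n. 0)"
      then show "tsirelson_step N x = 0" using scale_le[OF x, of 0] nn by simp
    qed
    fix a :: 'k
    show "tsirelson_step N (\<lambda>n. a * x n) = norm a * tsirelson_step N x"
    proof (cases "a = 0")
      case True
      then show ?thesis using scale_le[OF x, of 0] ge[of "\<lambda>n. 0"] by (simp)
    next
      case False
      have "tsirelson_step N (\<lambda>n. inverse a * (a * x n))
          \<le> norm (inverse a) * tsirelson_step N (\<lambda>n. a * x n)"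
        by (rule scale_le[OF scale_c00[OF x]])
      then have "norm a * tsirelson_step N x \<le> tsirelson_step N (\<lambda>n. a * x n)"
        using False by (simp add: mult.assoc[symmetric] norm_inverse)
          (simp add: field_simps)
      then show ?thesis using scale_le[OF x, of a] by simp
    qed
  next
    fix x y :: "nat \<Rightarrow> 'k" assume x: "x \<in> c00" and y: "y \<in> c00"
    show "tsirelson_step N (\<lambda>n. x n + y n) \<le> tsirelson_step N x + tsirelson_step N y"
      unfolding tsirelson_step_le_iff[OF N add_c00[OF x y]]
    proof (intro conjI ballI)
      show "(SUP n. norm (x n + y n)) \<le> tsirelson_step N x + tsirelson_step N y"
        using sup_norm x y ge[of x] ge[of y] by (fastforce simp: norm_on_c00_def)
      fix s assume "s \<in> tsirelson_sums N (\<lambda>n. x n + y n)"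
      then obtain k E where E: "1 \<le> k" "successive k E" "k \<le> Min (E 1)"
        and s: "s = (\<Sum>j=1..k. N (restr (E j) (\<lambda>n. x n + y n)))"
        by (auto simp: tsirelson_sums_def)
      have "restr (E j) (\<lambda>n. x n + y n) = (\<lambda>n. restr (E j) x n + restr (E j) y n)" for j
        by (auto simp: restr_def)
      then have "s \<le> (\<Sum>j=1..k. N (restr (E j) x)) + (\<Sum>j=1..k. N (restr (E j) y))"
        unfolding s sum.distrib[symmetric] using N restr_c00[OF x] restr_c00[OF y]
        by (auto simp: norm_on_c00_def intro!: sum_mono)
      moreover have "(\<Sum>j=1..k. N (restr (E j) x)) \<in> tsirelson_sums N x"
        "(\<Sum>j=1..k. N (restr (E j) y)) \<in> tsirelson_sums N y"
        using E by (auto simp: tsirelson_sums_def)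
      then have "1/2 * (\<Sum>j=1..k. N (restr (E j) x)) \<le> tsirelson_step N x"
        "1/2 * (\<Sum>j=1..k. N (restr (E j) y)) \<le> tsirelson_step N y"
        using tsirelson_step_le_iff[OF N x, of "tsirelson_step N x"]
          tsirelson_step_le_iff[OF N y, of "tsirelson_step N y"] by auto
      ultimately show "1/2 * s \<le> tsirelson_step N x + tsirelson_step N y" by simp
    qed
  qed
qed

lemma tsirelson_step_mono:
  fixes N M :: "(nat \<Rightarrow> 'k::real_normed_field) \<Rightarrow> real"
  assumes N: "norm_on_c00 N" and M: "norm_on_c00 M" and x: "x \<in> c00"
    and le: "\<And>x. x \<in> c00 \<Longrightarrow> N x \<le> M x"
  shows "tsirelson_step N x \<le> tsirelson_step M x"
  unfolding tsirelson_step_le_iff[OF N x]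
proof (intro conjI ballI)
  show "(SUP n. norm (x n)) \<le> tsirelson_step M x" by (simp add: tsirelson_step_def)
  fix s assume "s \<in> tsirelson_sums N x"
  then obtain k E where E: "1 \<le> k" "successive k E" "k \<le> Min (E 1)"
    and s: "s = (\<Sum>j=1..k. N (restr (E j) x))"
    by (auto simp: tsirelson_sums_def)
  have "s \<le> (\<Sum>j=1..k. M (restr (E j) x))"
    unfolding s by (intro sum_mono le restr_c00 x)
  moreover have "(\<Sum>j=1..k. M (restr (E j) x)) \<in> tsirelson_sums M x"
    using E by (auto simp: tsirelson_sums_def)
  then have "1/2 * (\<Sum>j=1..k. M (restr (E j) x)) \<le> tsirelson_step M x"
    using tsirelson_step_le_iff[OF M x, of "tsirelson_step M x"] by auto
  ultimately show "1/2 * s \<le> tsirelson_step M x" by simp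
qed

primrec tsirelson_iter :: "nat \<Rightarrow> (nat \<Rightarrow> 'k::real_normed_field) \<Rightarrow> real" where
  "tsirelson_iter 0 = (\<lambda>x. SUP n. norm (x n))"
| "tsirelson_iter (Suc m) = tsirelson_step (tsirelson_iter m)"

lemma tsirelson_iter_norm: "norm_on_c00 (tsirelson_iter m)"
  by (induction m) (simp_all add: sup_norm tsirelson_step_norm)

lemma tsirelson_iter_mono: "x \<in> c00 \<Longrightarrow> tsirelson_iter m x \<le> tsirelson_iter (Suc m) x"
proof (induction m arbitrary: x)
  case 0
  then show ?case by (simp add: tsirelson_step_def)
next
  case (Suc m)
  then show ?case
    using tsirelson_step_mono[OF tsirelson_iter_norm tsirelson_iter_norm, of x m "Suc m"] by simp
qed

lemma tsirelson_iter_le: "x \<in> c00 \<Longrightarrow> tsirelson_iter m x \<le> (\<Sum>n | x n \<noteq> 0. norm (x n))"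
proof (induction m arbitrary: x)
  have sup: "(SUP n. norm (x n)) \<le> (\<Sum>n | x n \<noteq> 0. norm (x n))" if "x \<in> c00" for x :: "nat \<Rightarrow> 'a"
  proof (rule cSUP_least)
    show "norm (x n) \<le> (\<Sum>n | x n \<noteq> 0. norm (x n))" for n
    proof (cases "x n = 0")
      case False
      then show ?thesis using that
        by (intro member_le_sum[of n _ "\<lambda>n. norm (x n)"]) (auto simp: c00_def)
    qed (auto intro: sum_nonneg)
  qed auto
  {
    case 0
    then show ?case using sup by simp
  next
    case (Suc m)
    show ?case
      unfolding tsirelson_iter.simps tsirelson_step_le_iff[OF tsirelson_iter_norm Suc.prems]
    proof (intro conjI ballI)
      show "(SUP n. norm (x n)) \<le> (\<Sum>n | x n \<noteq> 0. norm (x n))" by (rule sup[OF Suc.prems])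
      fix s assume "s \<in> tsirelson_sums (tsirelson_iter m) x"
      then obtain k E where E: "successive k E"
        and s: "s = (\<Sum>j=1..k. tsirelson_iter m (restr (E j) x))"
        by (auto simp: tsirelson_sums_def)
      have "tsirelson_iter m (restr (E j) x) \<le> (\<Sum>n\<in>E j. norm (x n))" if "j \<in> {1..k}" for j
      proof -
        have "tsirelson_iter m (restr (E j) x) \<le> (\<Sum>n | restr (E j) x n \<noteq> 0. norm (restr (E j) x n))"
          by (rule Suc.IH[OF restr_c00[OF Suc.prems]])
        also have "\<dots> = (\<Sum>n\<in>E j. norm (x n))"
          using that E by (intro sum.mono_neutral_cong_left) (auto simp: successive_def restr_def)
        finally show ?thesis .
      qed
      then have "s \<le> (\<Sum>j=1..k. \<Sum>n\<in>E j. norm (x n))" unfolding s by (rule sum_mono)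
      also have "\<dots> \<le> (\<Sum>n | x n \<noteq> 0. norm (x n))"
        by (rule sum_coordinates_le[OF E Suc.prems]) auto
      finally show "1/2 * s \<le> (\<Sum>n | x n \<noteq> 0. norm (x n))"
        using sum_nonneg[of "{n. x n \<noteq> 0}" "\<lambda>n. norm (x n)"] by simp
    qed
  }
qed

lemma tsirelson_norm_exists: "\<exists>N :: (nat \<Rightarrow> 'k::real_normed_field) \<Rightarrow> real. is_tsirelson_norm N"
proof -
  define N :: "(nat \<Rightarrow> 'k) \<Rightarrow> real" where
    "N x = (if x \<in> c00 then SUP m. tsirelson_iter m x else 0)" for x
  have bdd: "bdd_above (range (\<lambda>m. tsirelson_iter m x))" if "x \<in> c00" for x :: "nat \<Rightarrow> 'k"
    using tsirelson_iter_le[OF that] by (intro bdd_aboveI2) auto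
  have lim: "(\<lambda>m. tsirelson_iter m x) \<longlonglongrightarrow> N x" if "x \<in> c00" for x
    unfolding N_def using that
    by (auto intro!: LIMSEQ_incseq_SUP bdd incseq_SucI tsirelson_iter_mono)
  have up: "tsirelson_iter m x \<le> N x" if "x \<in> c00" for m x
    unfolding N_def using that by (auto intro: cSUP_upper bdd)
  have normN: "norm_on_c00 N"
    unfolding norm_on_c00_def
  proof (intro conjI ballI allI)
    fix x :: "nat \<Rightarrow> 'k" assume x: "x \<in> c00"
    have it: "0 \<le> tsirelson_iter m x" "tsirelson_iter m x = 0 \<longleftrightarrow> x = (\<lambda>n. 0)" for m
      using tsirelson_iter_norm[of m] x by (auto simp: norm_on_c00_def)
    show "0 \<le> N x" using it(1)[of 0] up[OF x, of 0] by simp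
    show "(N x = 0) = (x = (\<lambda>n. 0))"
    proof
      assume "N x = 0"
      then show "x = (\<lambda>n. 0)" using it[of 0] up[OF x, of 0] by simp
    next
      assume "x = (\<lambda>n. 0)"
      then show "N x = 0" using lim[OF x] it(2) by (simp add: LIMSEQ_const_iff)
    qed
    fix a :: 'k
    have "tsirelson_iter m (\<lambda>n. a * x n) = norm a * tsirelson_iter m x" for m
      using tsirelson_iter_norm[of m] x by (auto simp: norm_on_c00_def)
    then have "(\<lambda>m. tsirelson_iter m (\<lambda>n. a * x n)) \<longlonglongrightarrow> norm a * N x"
      using tendsto_mult[OF tendsto_const[of "norm a"] lim[OF x]] by simp
    then show "N (\<lambda>n. a * x n) = norm a * N x"
      using lim[OF scale_c00[OF x]] LIMSEQ_unique by blast
  next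
    fix x y :: "nat \<Rightarrow> 'k" assume x: "x \<in> c00" and y: "y \<in> c00"
    have "tsirelson_iter m (\<lambda>n. x n + y n) \<le> tsirelson_iter m x + tsirelson_iter m y" for m
      using tsirelson_iter_norm[of m] x y by (auto simp: norm_on_c00_def)
    then show "N (\<lambda>n. x n + y n) \<le> N x + N y"
      by (intro LIMSEQ_le[OF lim[OF add_c00[OF x y]] tendsto_add[OF lim[OF x] lim[OF y]]]) auto
  qed
  have "N x = tsirelson_step N x" if x: "x \<in> c00" for x
  proof (rule antisym)
    have "tsirelson_iter m x \<le> tsirelson_step N x" for m
    proof -
      have "tsirelson_iter m x \<le> tsirelson_iter (Suc m) x" by (rule tsirelson_iter_mono[OF x])
      also have "\<dots> \<le> tsirelson_step N x"
        using tsirelson_step_mono[OF tsirelson_iter_norm normN x up] by simp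
      finally show ?thesis .
    qed
    then show "N x \<le> tsirelson_step N x" using LIMSEQ_le_const2[OF lim[OF x]] by blast
    show "tsirelson_step N x \<le> N x"
      unfolding tsirelson_step_le_iff[OF normN x]
    proof (intro conjI ballI)
      show "(SUP n. norm (x n)) \<le> N x" using up[OF x, of 0] by simp
      fix s assume "s \<in> tsirelson_sums N x"
      then obtain k E where E: "1 \<le> k" "successive k E" "k \<le> Min (E 1)"
        and s: "s = (\<Sum>j=1..k. N (restr (E j) x))"
        by (auto simp: tsirelson_sums_def)
      have "(\<lambda>m. 1/2 * (\<Sum>j=1..k. tsirelson_iter m (restr (E j) x))) \<longlonglongrightarrow> 1/2 * s"
        unfolding s by (intro tendsto_intros lim restr_c00 x)
      moreover have "1/2 * (\<Sum>j=1..k. tsirelson_iter m (restr (E j) x)) \<le> N x" for m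
      proof -
        have "(\<Sum>j=1..k. tsirelson_iter m (restr (E j) x)) \<in> tsirelson_sums (tsirelson_iter m) x"
          using E by (auto simp: tsirelson_sums_def)
        then have "1/2 * (\<Sum>j=1..k. tsirelson_iter m (restr (E j) x)) \<le> tsirelson_iter (Suc m) x"
          using tsirelson_step_le_iff[OF tsirelson_iter_norm x, of m "tsirelson_iter (Suc m) x"] by auto
        then show ?thesis using up[OF x, of "Suc m"] by linarith
      qed
      ultimately show "1/2 * s \<le> N x" using LIMSEQ_le_const2 by blast
    qed
  qed
  then have "is_tsirelson_norm N"
    using normN by (auto simp: is_tsirelson_norm_def tsirelson_step_def N_def)
  then show ?thesis by blast
qed

lemma tsirelson_norm_le:
  fixes N M :: "(nat \<Rightarrow> 'k::real_normed_field) \<Rightarrow> real"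
  assumes N: "is_tsirelson_norm N" and M: "is_tsirelson_norm M" and "x \<in> c00"
  shows "N x \<le> M x"
  using assms(3)
proof (induction "card {n. x n \<noteq> 0}" arbitrary: x rule: less_induct)
  case less
  note x = less.prems
  have nN: "norm_on_c00 N" and nM: "norm_on_c00 M"
    using N M by (auto simp: is_tsirelson_norm_def)
  have eN: "N x = tsirelson_step N x" and eM: "M x = tsirelson_step M x"
    using N M x by (auto simp: is_tsirelson_norm_def tsirelson_step_def)
  have pos: "0 \<le> N x" "0 \<le> M x" using nN nM x by (auto simp: norm_on_c00_def)
  have "tsirelson_step N x \<le> max (1/2 * N x) (M x)"
    unfolding tsirelson_step_le_iff[OF nN x]
  proof (intro conjI ballI)
    have "(SUP n. norm (x n)) \<le> M x" unfolding eM by (simp add: tsirelson_step_def)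
    then show "(SUP n. norm (x n)) \<le> max (1/2 * N x) (M x)" by simp
    fix s assume "s \<in> tsirelson_sums N x"
    then obtain k E where E: "1 \<le> k" "successive k E" "k \<le> Min (E 1)"
      and s: "s = (\<Sum>j=1..k. N (restr (E j) x))"
      by (auto simp: tsirelson_sums_def)
    show "1/2 * s \<le> max (1/2 * N x) (M x)"
    proof (cases "\<exists>i\<in>{1..k}. {n. x n \<noteq> 0} \<subseteq> E i")
      case True
      then obtain i where i: "i \<in> {1..k}" "{n. x n \<noteq> 0} \<subseteq> E i" by blast
      have "N (restr (E j) x) = (if j = i then N x else 0)" if "j \<in> {1..k}" for j
      proof (cases "j = i")
        case True
        have "restr (E i) x = x" using i by (fastforce simp: restr_def)
        then show ?thesis using True by simp
      next
        case False
        have "x n = 0" if "n \<in> E j" for n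
          using successive_disjoint[OF E(2) \<open>j \<in> {1..k}\<close> i(1) False] i(2) that by blast
        then have "restr (E j) x = (\<lambda>n. 0)" by (auto simp: restr_def)
        then show ?thesis using False nN zero_c00 by (auto simp: norm_on_c00_def)
      qed
      then have "s = (\<Sum>j=1..k. if j = i then N x else 0)" unfolding s by (intro sum.cong) auto
      then have "s = N x" using i by (simp add: sum.delta)
      then show ?thesis by simp
    next
      case False
      have "N (restr (E j) x) \<le> M (restr (E j) x)" if "j \<in> {1..k}" for j
      proof (rule less.hyps[OF _ restr_c00[OF x]])
        have "{n. restr (E j) x n \<noteq> 0} \<subset> {n. x n \<noteq> 0}"
          using False that by (auto simp: restr_def)
        then show "card {n. restr (E j) x n \<noteq> 0} < card {n. x n \<noteq> 0}"
          using x by (intro psubset_card_mono) (auto simp: c00_def)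
      qed
      then have "s \<le> (\<Sum>j=1..k. M (restr (E j) x))" unfolding s by (rule sum_mono)
      moreover have "(\<Sum>j=1..k. M (restr (E j) x)) \<in> tsirelson_sums M x"
        using E by (auto simp: tsirelson_sums_def)
      then have "1/2 * (\<Sum>j=1..k. M (restr (E j) x)) \<le> M x"
        using tsirelson_step_le_iff[OF nM x, of "M x"] eM by auto
      ultimately show ?thesis by simp
    qed
  qed
  then show ?case using eN pos by (auto simp: max_def split: if_splits)
qed

lemma tsirelson_norm_ex1: "\<exists>!N :: (nat \<Rightarrow> 'k::real_normed_field) \<Rightarrow> real. is_tsirelson_norm N"
proof (rule ex_ex1I[OF tsirelson_norm_exists])
  fix N M :: "(nat \<Rightarrow> 'k) \<Rightarrow> real"
  assume N: "is_tsirelson_norm N" and M: "is_tsirelson_norm M"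
  show "N = M"
  proof
    show "N x = M x" for x
      using tsirelson_norm_le[OF N M] tsirelson_norm_le[OF M N] N M
      by (cases "x \<in> c00") (auto simp: is_tsirelson_norm_def intro: antisym)
  qed
qed

lemma is_tsirelson_norm_tsirelson_norm: "is_tsirelson_norm tsirelson_norm"
  unfolding tsirelson_norm_def by (rule theI'[OF tsirelson_norm_ex1])

subsection \<open>The Baernstein norms\<close>

definition admissible :: "nat set \<Rightarrow> bool" where
  "admissible M \<longleftrightarrow> finite M \<and> M \<noteq> {} \<and> 0 \<notin> M \<and> card M \<le> Min M"

definition mu :: "(nat \<Rightarrow> 'k::real_normed_field) \<Rightarrow> nat set \<Rightarrow> real" where
  "mu x A = (\<Sum>n\<in>A. norm (x n))"

definition baernstein_norm :: "real \<Rightarrow> (nat \<Rightarrow> 'k::real_normed_field) \<Rightarrow> real" where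
  "baernstein_norm p x =
     Sup {(\<Sum>j=1..k. mu x (A j) powr p) powr (1 / p) | k A.
       1 \<le> k \<and> successive k A \<and> (\<forall>j\<in>{1..k}. admissible (A j))}"

end

theory Submission
  imports Defs
begin

text \<open>Let \<open>e\<^sub>1, e\<^sub>2, \<dots>\<close> be the unit vectors. For an operator \<open>S\<close> let \<open>L\<^sub>i S\<close> be the limit, along a fixed
  ultrafilter on \<open>n\<close>, of the coordinate \<open>n + i\<close> of \<open>S e\<^bsub>2n\<^esub>\<close>. In either space the norm dominates half
  the \<open>\<ell>\<^sub>1\<close>-norm over \<open>{n..<2n}\<close>, hence \<open>\<Sum>\<^sub>i \<bar>L\<^sub>i S\<bar> \<le> 2 \<parallel>S\<parallel>\<close>, and the tails \<open>f\<^sub>m = \<Sum>\<^bsub>i\<ge>m\<^esub> L\<^sub>i\<close> form a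
  weak*-null sequence. Both norms are right dominant, that is, moving coordinates to the left does
  not increase them, so there are contractions \<open>S\<^sub>M\<close> mapping \<open>e\<^bsub>2n\<^esub>\<close> to \<open>e\<^bsub>n+M\<^esub>\<close> for all \<open>n \<ge> M\<close>; they satisfy
  \<open>f\<^sub>m S\<^sub>M = 1\<close> for \<open>m \<le> M\<close>. Therefore the functional \<open>f \<mapsto> lim\<^sub>M f S\<^sub>M\<close> in the bidual is 1 on every
  \<open>f\<^sub>m\<close>, and the sequence is not weakly null.\<close>

section \<open>Limits along an ultrafilter\<close>

text \<open>Zorn's lemma for the reversed order on the proper filters below \<open>F\<close>; a
  non-empty chain is bounded by its infimum.\<close>

lemma ex_minimal_filter:
  fixes F :: "'a filter"
  assumes "F \<noteq> bot"
  shows "\<exists>U\<le>F. U \<noteq> bot \<and> (\<forall>G\<le>U. G \<noteq> bot \<longrightarrow> G = U)"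
proof -
  let ?A = "{G. G \<noteq> bot \<and> G \<le> F}"
  let ?P = "\<lambda>x y :: 'a filter. y \<le> x"
  have "\<exists>m\<in>?A. \<forall>a\<in>?A. ?P m a \<longrightarrow> a = m"
  proof (rule predicate_Zorn)
    show "partial_order_on ?A (relation_of ?P ?A)"
      by (rule partial_order_on_relation_ofI) auto
    fix C assume "C \<in> Chains (relation_of ?P ?A)"
    then have C: "C \<subseteq> ?A" and chain: "\<And>G H. G \<in> C \<Longrightarrow> H \<in> C \<Longrightarrow> G \<le> H \<or> H \<le> G"
      by (auto simp: Chains_def relation_of_def)
    show "\<exists>u\<in>?A. \<forall>a\<in>C. ?P a u"
    proof (cases "C = {}")
      case True
      then show ?thesis using assms by auto
    next
      case False
      \<comment> \<open>Any two members of a chain are comparable, so whatever holds eventually for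
        \<open>Inf C\<close> does so for some member; hence \<open>Inf C\<close> is proper.\<close>
      have "eventually P (Inf C) \<longleftrightarrow> (\<exists>G\<in>C. eventually P G)" for P
      proof (rule eventually_Inf_base[OF False])
        show "\<exists>x\<in>C. x \<le> inf G H" if "G \<in> C" "H \<in> C" for G H
          using chain[OF that] that by (metis inf.orderE inf_commute order_refl)
      qed
      then have "Inf C \<noteq> bot"
        using C by (auto simp: trivial_limit_def)
      moreover obtain G where "G \<in> C" using False by blast
      ultimately have "Inf C \<in> ?A" using C Inf_lower[of G C] by auto
      then show ?thesis using Inf_lower by blast
    qed
  qed
  then show ?thesis by (metis (mono_tags, lifting) mem_Collect_eq order_trans)
qed

text \<open>A minimal proper filter below \<open>sequentially\<close> is the same as a free ultrafilter.\<close>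

definition ultra :: "nat filter" where
  "ultra = (SOME U. U \<le> sequentially \<and> U \<noteq> bot \<and> (\<forall>G\<le>U. G \<noteq> bot \<longrightarrow> G = U))"

lemma ultra:
  shows ultra_le: "ultra \<le> sequentially"
    and ultra_neq_bot: "ultra \<noteq> bot"
    and ultra_minimal: "G \<le> ultra \<Longrightarrow> G \<noteq> bot \<Longrightarrow> G = ultra"
proof -
  have "\<exists>U. U \<le> sequentially \<and> U \<noteq> bot \<and> (\<forall>G\<le>U. G \<noteq> bot \<longrightarrow> G = U)"
    using ex_minimal_filter[OF sequentially_bot] by blast
  from someI_ex[OF this, folded ultra_def]
  show "ultra \<le> sequentially" "ultra \<noteq> bot" "G \<le> ultra \<Longrightarrow> G \<noteq> bot \<Longrightarrow> G = ultra"
    by blast+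
qed

text \<open>Compactness yields a cluster point \<open>l\<close> of \<open>s\<close> along
  \<open>ultra\<close>. Adjoining the preimages of the neighbourhoods of \<open>l\<close> therefore
  leaves \<open>ultra\<close> proper, so by minimality it changes nothing, which is convergence to
  \<open>l\<close>.\<close>

lemma ultra_converges:
  fixes s :: "nat \<Rightarrow> 'a::topological_space"
  assumes "compact K" "\<And>n. s n \<in> K"
  shows "\<exists>l. (s \<longlongrightarrow> l) ultra"
proof -
  have "filtermap s ultra \<noteq> bot" using ultra_neq_bot by (simp add: filtermap_bot_iff)
  then obtain l where l: "inf (nhds l) (filtermap s ultra) \<noteq> bot"
    using assms unfolding compact_filter by (metis (no_types, lifting) UNIV_I eventually_filtermap eventuallyI)
  let ?G = "inf (filtercomap s (nhds l)) ultra"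
  have "?G \<noteq> bot"
  proof
    assume "?G = bot"
    then have "eventually (\<lambda>_. False) ?G" by simp
    then obtain P Q where "eventually P (filtercomap s (nhds l))" "eventually Q ultra"
      and PQ: "\<And>n. P n \<Longrightarrow> Q n \<Longrightarrow> False" by (auto simp: eventually_inf)
    then obtain R where "eventually R (nhds l)" "\<And>n. R (s n) \<Longrightarrow> P n"
      by (auto simp: eventually_filtercomap)
    moreover have "eventually (\<lambda>y. \<not> R y) (filtermap s ultra)"
      using \<open>eventually Q ultra\<close> calculation(2) PQ by (auto simp: eventually_filtermap elim!: eventually_mono)
    ultimately have "eventually (\<lambda>_. False) (inf (nhds l) (filtermap s ultra))"
      unfolding eventually_inf by blast
    then show False using l by (simp add: trivial_limit_def)
  qed
  then have "?G = ultra" by (intro ultra_minimal) auto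
  then have "ultra \<le> filtercomap s (nhds l)" by (metis inf_le1)
  then have "(s \<longlongrightarrow> l) ultra" by (simp add: filterlim_iff_le_filtercomap)
  then show ?thesis by blast
qed

text \<open>The class only tells how the field is spanned over the reals. Bounding the real
  coefficients places the ball inside the continuous image of a compact interval or
  rectangle.\<close>

lemma compact_cball_real_or_complex: "compact (cball (0::'k::real_or_complex) B)"
proof -
  consider "\<forall>z::'k. \<exists>a. z = a *\<^sub>R 1"
    | i :: 'k where "i * i = - 1" "\<forall>z. \<exists>a b. z = a *\<^sub>R 1 + b *\<^sub>R i"
    using real_or_complex by blast
  then obtain K :: "'k set" where K: "compact K" "cball 0 B \<subseteq> K"
  proof cases
    case 1
    have "compact ((\<lambda>a. a *\<^sub>R (1::'k)) ` {-B..B})"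
      by (intro compact_continuous_image continuous_intros) auto
    moreover have "cball 0 B \<subseteq> (\<lambda>a. a *\<^sub>R (1::'k)) ` {-B..B}"
    proof
      fix z :: 'k assume z: "z \<in> cball 0 B"
      obtain a where "z = a *\<^sub>R 1" using 1 by blast
      then show "z \<in> (\<lambda>a. a *\<^sub>R (1::'k)) ` {-B..B}" using z by (auto simp: abs_le_iff)
    qed
    ultimately show ?thesis by (rule that)
  next
    case 2
    let ?g = "\<lambda>(a, b). a *\<^sub>R (1::'k) + b *\<^sub>R i" and ?R = "{-2*B..2*B} \<times> {-2*B..2*B}"
    have "compact (?g ` ?R)"
      by (intro compact_continuous_image compact_Times) (auto intro!: continuous_intros simp: case_prod_beta)
    moreover have "cball 0 B \<subseteq> ?g ` ?R"
    proof
      fix z :: 'k assume z: "z \<in> cball 0 B"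
      obtain a b where ab: "z = a *\<^sub>R 1 + b *\<^sub>R i" using 2 by blast
      have "norm i * norm i = 1" using 2(1) by (metis norm_minus_cancel norm_mult norm_one)
      then have i: "norm i = 1" by (metis norm_ge_zero abs_of_nonneg abs_square_eq_1 power2_eq_square)
      define s where "s = \<bar>a\<bar> + \<bar>b\<bar>"
      \<comment> \<open>Multiplying by the conjugate gives \<open>a * a + b * b\<close>.
        Multiplicativity of the norm then bounds \<open>s\<close> by \<open>2 * norm z\<close>,
        whence the rectangle of half-width \<open>2 * B\<close>.\<close>
      have "z * (a *\<^sub>R 1 - b *\<^sub>R i) = (a * a) *\<^sub>R 1 - (b * b) *\<^sub>R (i * i)"
        unfolding ab by (simp add: algebra_simps)
      also have "\<dots> = (a * a + b * b) *\<^sub>R 1" by (simp add: 2(1) scaleR_add_left)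
      finally have "norm z * norm (a *\<^sub>R 1 - b *\<^sub>R i) = a * a + b * b"
        by (metis abs_of_nonneg mult.right_neutral norm_mult norm_one norm_scaleR sum_squares_ge_zero)
      moreover have "norm (a *\<^sub>R 1 - b *\<^sub>R i) \<le> s"
        unfolding s_def using norm_triangle_ineq4[of "a *\<^sub>R 1" "b *\<^sub>R i"] i by simp
      ultimately have "a * a + b * b \<le> norm z * s"
        by (metis mult_left_mono norm_ge_zero)
      moreover have "s * s \<le> 2 * (a * a + b * b)"
      proof -
        have "0 \<le> (\<bar>a\<bar> - \<bar>b\<bar>) * (\<bar>a\<bar> - \<bar>b\<bar>)" by simp
        then show ?thesis unfolding s_def by (simp add: algebra_simps)
      qed
      ultimately have "s * s \<le> (2 * norm z) * s" by simp
      then have "s \<le> 2 * norm z" using s_def by (cases "s = 0") (auto simp: mult_le_cancel_right)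
      then have "\<bar>a\<bar> \<le> 2 * B" "\<bar>b\<bar> \<le> 2 * B" using z unfolding s_def by auto
      then show "z \<in> ?g ` ?R" unfolding ab by (intro image_eqI[of _ _ "(a, b)"]) auto
    qed
    ultimately show ?thesis by (rule that)
  qed
  have "compact (K \<inter> cball 0 B)" using K(1) by (intro compact_Int_closed) auto
  then show ?thesis using K(2) by (simp add: Int_absorb1)
qed

definition ulim :: "(nat \<Rightarrow> 'k::t2_space) \<Rightarrow> 'k" where
  "ulim s = Lim ultra s"

lemma ulim_eqI: "(s \<longlongrightarrow> l) ultra \<Longrightarrow> ulim s = l"
  unfolding ulim_def by (rule tendsto_Lim[OF ultra_neq_bot])

lemma ulim_eq_lim: "s \<longlonglongrightarrow> l \<Longrightarrow> ulim s = l"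
  by (rule ulim_eqI[OF tendsto_mono[OF ultra_le]])

lemma tendsto_ulim:
  fixes s :: "nat \<Rightarrow> 'k::real_or_complex"
  assumes "\<And>n. norm (s n) \<le> B"
  shows "(s \<longlongrightarrow> ulim s) ultra"
proof -
  obtain l where "(s \<longlongrightarrow> l) ultra"
    using ultra_converges[OF compact_cball_real_or_complex, of s B] assms by auto
  then show ?thesis using ulim_eqI by metis
qed

lemma norm_ulim_le:
  fixes s :: "nat \<Rightarrow> 'k::real_or_complex"
  assumes "\<And>n. norm (s n) \<le> B"
  shows "norm (ulim s) \<le> B"
  by (rule tendsto_upperbound[OF tendsto_norm[OF tendsto_ulim[OF assms]] _ ultra_neq_bot])
     (simp add: assms)

lemma ulim_add:
  fixes s t :: "nat \<Rightarrow> 'k::real_or_complex"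
  assumes "\<And>n. norm (s n) \<le> B" "\<And>n. norm (t n) \<le> C"
  shows "ulim (\<lambda>n. s n + t n) = ulim s + ulim t"
  by (intro ulim_eqI tendsto_add tendsto_ulim[OF assms(1)] tendsto_ulim[OF assms(2)])

lemma ulim_mult:
  fixes s :: "nat \<Rightarrow> 'k::real_or_complex"
  assumes "\<And>n. norm (s n) \<le> B"
  shows "ulim (\<lambda>n. a * s n) = a * ulim s"
  by (intro ulim_eqI tendsto_mult tendsto_const tendsto_ulim[OF assms])

section \<open>A criterion for failing the Grothendieck property\<close>

lemma dualI:
  assumes "\<And>x y. x \<in> points Y \<Longrightarrow> y \<in> points Y \<Longrightarrow> f (add Y x y) = f x + f y"
    and "\<And>a x. x \<in> points Y \<Longrightarrow> f (smult Y a x) = a * f x"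
    and "\<And>x. x \<in> points Y \<Longrightarrow> norm (f x) \<le> K * nrm Y x"
    and "\<And>x. x \<notin> points Y \<Longrightarrow> f x = 0"
  shows "f \<in> points (dual Y)"
  unfolding dual_def using assms by (simp, blast)

lemma dual_bounded: "f \<in> points (dual Y) \<Longrightarrow> \<exists>K. \<forall>x\<in>points Y. norm (f x) \<le> K * nrm Y x"
  by (simp add: dual_def)

lemma norm_le_dual_norm:
  assumes "f \<in> points (dual Y)" "\<And>y. y \<in> points Y \<Longrightarrow> 0 \<le> nrm Y y" "x \<in> points Y" "nrm Y x \<le> 1"
  shows "norm (f x) \<le> nrm (dual Y) f"
proof -
  obtain K where K: "\<And>x. x \<in> points Y \<Longrightarrow> norm (f x) \<le> K * nrm Y x"
    using dual_bounded[OF assms(1)] by blast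
  have "norm (f y) \<le> \<bar>K\<bar>" if y: "y \<in> points Y" "nrm Y y \<le> 1" for y
  proof -
    have "K * nrm Y y \<le> \<bar>K\<bar> * 1"
      using y assms(2)[OF y(1)] by (intro mult_mono) auto
    then show ?thesis using K[OF y(1)] by simp
  qed
  then have "bdd_above {norm (f y) | y. y \<in> points Y \<and> nrm Y y \<le> 1}"
    by (intro bdd_aboveI[of _ "\<bar>K\<bar>"]) auto
  then show ?thesis
    using assms(3,4) by (auto simp: dual_def intro!: cSup_upper)
qed

lemma dual_closed:
  assumes "\<And>y. y \<in> points Y \<Longrightarrow> 0 \<le> nrm Y y"
  shows dual_add_closed: "f \<in> points (dual Y) \<Longrightarrow> g \<in> points (dual Y) \<Longrightarrow>
      (\<lambda>x. f x + g x) \<in> points (dual Y)"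
    and dual_mult_closed: "f \<in> points (dual Y) \<Longrightarrow> (\<lambda>x. a * f x) \<in> points (dual Y)"
proof -
  assume f: "f \<in> points (dual Y)"
  obtain K where K: "\<And>x. x \<in> points Y \<Longrightarrow> norm (f x) \<le> K * nrm Y x"
    using dual_bounded[OF f] by blast
  show "(\<lambda>x. a * f x) \<in> points (dual Y)"
  proof (rule dualI)
    show "norm (a * f x) \<le> (norm a * K) * nrm Y x" if "x \<in> points Y" for x
      using mult_left_mono[OF K[OF that], of "norm a"] by (simp add: norm_mult mult.assoc)
  qed (use f in \<open>auto simp: dual_def algebra_simps\<close>)
  assume g: "g \<in> points (dual Y)"
  obtain L where L: "\<And>x. x \<in> points Y \<Longrightarrow> norm (g x) \<le> L * nrm Y x"
    using dual_bounded[OF g] by blast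
  show "(\<lambda>x. f x + g x) \<in> points (dual Y)"
  proof (rule dualI)
    show "norm (f x + g x) \<le> (K + L) * nrm Y x" if "x \<in> points Y" for x
      using norm_triangle_ineq[of "f x" "g x"] K[OF that] L[OF that] by (simp add: algebra_simps)
  qed (use f g in \<open>auto simp: dual_def algebra_simps\<close>)
qed

text \<open>The Grothendieck property provides some weak limit \<open>h\<close>. Evaluation at a
  single \<open>S n\<close> lies in the bidual, so \<open>h\<close> vanishes at every
  \<open>S n\<close>. The ultrafilter limit of these evaluations is then 0 at \<open>h\<close> but 1
  at every \<open>f m\<close>.\<close>

lemma not_grothendieck_spaceI:
  fixes Y :: "('k::real_or_complex, 'b) nspace"
  assumes nonneg: "\<And>y. y \<in> points Y \<Longrightarrow> 0 \<le> nrm Y y"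
    and f: "\<And>m. f m \<in> points (dual Y)"
    and null: "\<And>y. y \<in> points Y \<Longrightarrow> (\<lambda>m. f m y) \<longlonglongrightarrow> 0"
    and S: "\<And>n. S n \<in> points Y" "\<And>n. nrm Y (S n) \<le> 1"
    and one: "\<And>m n. m \<le> n \<Longrightarrow> f m (S n) = 1"
  shows "\<not> grothendieck_space Y"
proof
  assume "grothendieck_space Y"
  moreover have "(\<lambda>_. 0) \<in> points (dual Y)" by (rule dualI[where K = 0]) auto
  then have "\<exists>g\<in>points (dual Y). weak_star_converges Y f g"
    using null unfolding weak_star_converges_def by (intro bexI[of _ "\<lambda>_. 0"]) auto
  ultimately obtain h where h: "h \<in> points (dual Y)"
    and weak: "\<And>\<phi>. \<phi> \<in> points (dual (dual Y)) \<Longrightarrow> (\<lambda>m. \<phi> (f m)) \<longlonglongrightarrow> \<phi> h"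
    using f unfolding grothendieck_space_def weak_converges_def by blast
  let ?D = "points (dual Y)"
  have add: "add (dual Y) u v = (\<lambda>x. u x + v x)" "smult (dual Y) a u = (\<lambda>x. a * u x)" for u v a
    by (auto simp: dual_def)
  note closed = dual_add_closed[OF nonneg] dual_mult_closed[OF nonneg]
  have bound: "norm (u (S n)) \<le> nrm (dual Y) u" if "u \<in> ?D" for u n
    by (rule norm_le_dual_norm[OF that nonneg S(1) S(2)])
  have "h (S n) = 0" for n
  proof -
    \<comment> \<open>The value 0 off \<open>?D\<close> is the normalisation that
      \<open>dual\<close> demands.\<close>
    let ?\<phi> = "\<lambda>u. if u \<in> ?D then u (S n) else 0"
    have "?\<phi> \<in> points (dual (dual Y))"
      by (rule dualI[where K = 1]) (auto simp: add closed bound)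
    from weak[OF this] have "(\<lambda>m. f m (S n)) \<longlonglongrightarrow> h (S n)" using f h by simp
    then show ?thesis using null[OF S(1)] LIMSEQ_unique by blast
  qed
  moreover
  let ?\<phi> = "\<lambda>u. if u \<in> ?D then ulim (\<lambda>n. u (S n)) else 0"
  have "?\<phi> \<in> points (dual (dual Y))"
  proof (rule dualI[where K = 1], goal_cases)
    case (1 u v)
    then show ?case using ulim_add[OF bound bound, of u v] by (simp add: add closed)
  next
    case (2 a u)
    then show ?case using ulim_mult[OF bound, of u a] by (simp add: add closed)
  next
    case (3 u)
    then show ?case using norm_ulim_le[OF bound, of u] by simp
  qed simp
  from weak[OF this] have "(\<lambda>m. ulim (\<lambda>n. f m (S n))) \<longlonglongrightarrow> ulim (\<lambda>n. h (S n))"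
    using f h by simp
  \<comment> \<open>For fixed \<open>m\<close> the sequence is constantly 1 from index
    \<open>m\<close> on.\<close>
  moreover have "ulim (\<lambda>n. f m (S n)) = 1" for m
    by (rule ulim_eq_lim, rule tendsto_eventually)
       (use one in \<open>auto simp: eventually_sequentially\<close>)
  ultimately show False
    using ulim_eq_lim[OF tendsto_const, of "0::'k"] by (simp add: LIMSEQ_const_iff)
qed


section \<open>Operators on completions of the finitely supported sequences\<close>

definition unit_seq :: "nat \<Rightarrow> nat \<Rightarrow> 'k::real_normed_field" where
  "unit_seq n = (\<lambda>j. if j = n then 1 else 0)"

lemma unit_seq_c00: "1 \<le> n \<Longrightarrow> unit_seq n \<in> c00"
  by (auto simp: unit_seq_def c00_def)

lemma comp_c00:
  assumes "x \<in> c00" "strict_mono \<sigma>" "\<sigma> 0 = 0"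
  shows "x \<circ> \<sigma> \<in> c00"
proof -
  have "finite (\<sigma> -` {n. x n \<noteq> 0})"
    using assms by (intro finite_vimageI) (auto simp: c00_def strict_mono_imp_inj_on)
  then show ?thesis using assms by (simp add: c00_def vimage_def)
qed

lemma diff_c00:
  assumes "x \<in> c00" "y \<in> c00"
  shows "(\<lambda>n. x n - y n) \<in> c00"
  using add_c00[OF assms(1) scale_c00[OF assms(2), of "-1"]] by simp

text \<open>The last four assumptions are the only properties of the particular norm that enter:
  bounded coordinates, the lower \<ell>_1-estimate on \<open>{n..<2 * n}\<close>, bounded unit
  vectors, and right dominance. The latter is \<open>comp_le\<close>, as
  \<open>x \<circ> \<sigma>\<close> moves coordinate \<open>\<sigma> j\<close> left to
  \<open>j\<close>.\<close>

locale sequence_completion = banach_over smul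
  for smul :: "'k::real_or_complex \<Rightarrow> 'v::banach \<Rightarrow> 'v" +
  fixes N :: "(nat \<Rightarrow> 'k) \<Rightarrow> real" and \<iota> :: "(nat \<Rightarrow> 'k) \<Rightarrow> 'v"
  assumes embed_add: "x \<in> c00 \<Longrightarrow> y \<in> c00 \<Longrightarrow> \<iota> (\<lambda>n. x n + y n) = \<iota> x + \<iota> y"
    and embed_scale: "x \<in> c00 \<Longrightarrow> \<iota> (\<lambda>n. a * x n) = smul a (\<iota> x)"
    and norm_embed: "x \<in> c00 \<Longrightarrow> norm (\<iota> x) = N x"
    and dense: "closure (\<iota> ` c00) = UNIV"
    and coordinate_le: "x \<in> c00 \<Longrightarrow> norm (x j) \<le> N x"
    and sum_le: "x \<in> c00 \<Longrightarrow> (\<Sum>i<n. norm (x (n + i))) \<le> 2 * N x"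
    and unit_le: "1 \<le> n \<Longrightarrow> N (unit_seq n) \<le> 1"
    and comp_le: "x \<in> c00 \<Longrightarrow> strict_mono \<sigma> \<Longrightarrow> \<sigma> 0 = 0 \<Longrightarrow> N (x \<circ> \<sigma>) \<le> N x"
begin

lemma bounded_linear_smul: "bounded_linear (smul a)"
proof (rule bounded_linear_intro)
  show "smul a (r *\<^sub>R x) = r *\<^sub>R smul a x" for r x
    by (simp add: scale_of_real[symmetric] mult.commute)
  show "norm (smul a x) \<le> norm x * norm a" for x
    by (simp add: norm_scale mult.commute)
qed (rule scale_right_distrib)

lemma embed_diff:
  assumes "x \<in> c00" "y \<in> c00"
  shows "\<iota> (\<lambda>n. x n - y n) = \<iota> x - \<iota> y"
  using embed_add[OF assms(1) scale_c00[OF assms(2), of "-1"]] embed_scale[OF assms(2), of "-1"]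
  by simp

lemma dist_embed: "x \<in> c00 \<Longrightarrow> y \<in> c00 \<Longrightarrow> norm (\<iota> x - \<iota> y) = N (\<lambda>n. x n - y n)"
  by (simp add: embed_diff[symmetric] norm_embed diff_c00)

section \<open>Coordinate functionals on the completion\<close>

definition approx :: "'v \<Rightarrow> nat \<Rightarrow> nat \<Rightarrow> 'k" where
  "approx v = (SOME x. (\<forall>n. x n \<in> c00) \<and> (\<lambda>n. \<iota> (x n)) \<longlonglongrightarrow> v)"

lemma approx:
  shows approx_c00: "approx v n \<in> c00"
    and approx_tendsto: "(\<lambda>n. \<iota> (approx v n)) \<longlonglongrightarrow> v"
proof -
  obtain u where u: "\<And>n. u n \<in> \<iota> ` c00" "u \<longlonglongrightarrow> v"
    using dense closure_sequential[of v "\<iota> ` c00"] by auto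
  obtain x where "\<And>n. x n \<in> c00" and x: "\<And>n. u n = \<iota> (x n)"
    using u(1) unfolding image_iff by metis
  have "u = (\<lambda>n. \<iota> (x n))" by (rule ext, rule x)
  then have "\<exists>x. (\<forall>n. x n \<in> c00) \<and> (\<lambda>n. \<iota> (x n)) \<longlonglongrightarrow> v"
    using u(2) \<open>\<And>n. x n \<in> c00\<close> by (intro exI[of _ x]) simp
  from someI_ex[OF this, folded approx_def]
  show "approx v n \<in> c00" "(\<lambda>n. \<iota> (approx v n)) \<longlonglongrightarrow> v" by auto
qed

lemma embed_diff_tendsto_0:
  assumes "\<And>n. y n \<in> c00" "(\<lambda>n. \<iota> (y n)) \<longlonglongrightarrow> v"
  shows "(\<lambda>n. N (\<lambda>j. y n j - approx v n j)) \<longlonglongrightarrow> 0"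
  using tendsto_norm[OF tendsto_diff[OF assms(2) approx_tendsto[of v]]]
  by (simp add: dist_embed assms(1) approx_c00)

text \<open>The limit along \<open>ultra\<close> is in fact an ordinary limit, but completeness of the scalar field is
  not available from its type class.\<close>

definition coord :: "nat \<Rightarrow> 'v \<Rightarrow> 'k" where
  "coord j v = ulim (\<lambda>n. approx v n j)"

text \<open>Sequences with a common limit differ by a null sequence, and coordinates are dominated
  by the norm. So the choice made in \<open>approx\<close> is immaterial, and linearity of
  \<open>coord\<close> follows by taking sums and multiples of approximating sequences.\<close>

lemma tendsto_coord:
  assumes y: "\<And>n. y n \<in> c00" "(\<lambda>n. \<iota> (y n)) \<longlonglongrightarrow> v"
  shows "((\<lambda>n. y n j) \<longlongrightarrow> coord j v) ultra"
proof -
  obtain B where B: "\<And>n. norm (\<iota> (approx v n)) \<le> B"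
    using convergent_imp_Bseq[OF convergentI[OF approx_tendsto[of v]]] by (auto simp: Bseq_def)
  have "norm (approx v n j) \<le> B" for n
    using coordinate_le[OF approx_c00, of v n j] B[of n] by (simp add: norm_embed approx_c00)
  then have lim: "((\<lambda>n. approx v n j) \<longlongrightarrow> coord j v) ultra"
    unfolding coord_def by (rule tendsto_ulim)
  have "(\<lambda>n. y n j - approx v n j) \<longlonglongrightarrow> 0"
    by (rule Lim_null_comparison[OF always_eventually embed_diff_tendsto_0[OF y]])
       (use coordinate_le[OF diff_c00[OF y(1) approx_c00]] in auto)
  from tendsto_add[OF tendsto_mono[OF ultra_le this] lim] show ?thesis by simp
qed

lemma coord_embed: "x \<in> c00 \<Longrightarrow> coord j (\<iota> x) = x j"
  using tendsto_coord[of "\<lambda>_. x" "\<iota> x" j] tendsto_unique[OF ultra_neq_bot] tendsto_const by blast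

lemma coord_add: "coord j (v + w) = coord j v + coord j w"
proof -
  have "(\<lambda>n. \<iota> (\<lambda>k. approx v n k + approx w n k)) \<longlonglongrightarrow> v + w"
    using tendsto_add[OF approx_tendsto[of v] approx_tendsto[of w]]
    by (simp add: embed_add approx_c00)
  from tendsto_coord[OF add_c00[OF approx_c00 approx_c00] this]
  have "((\<lambda>n. approx v n j + approx w n j) \<longlongrightarrow> coord j (v + w)) ultra" .
  moreover have "((\<lambda>n. approx v n j + approx w n j) \<longlongrightarrow> coord j v + coord j w) ultra"
    by (intro tendsto_add tendsto_coord approx)
  ultimately show ?thesis by (rule tendsto_unique[OF ultra_neq_bot])
qed

lemma coord_smul: "coord j (smul a v) = a * coord j v"
proof -
  have "(\<lambda>n. \<iota> (\<lambda>k. a * approx v n k)) \<longlonglongrightarrow> smul a v"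
    using bounded_linear.tendsto[OF bounded_linear_smul approx_tendsto[of v]]
    by (simp add: embed_scale approx_c00)
  from tendsto_coord[OF scale_c00[OF approx_c00] this]
  have "((\<lambda>n. a * approx v n j) \<longlongrightarrow> coord j (smul a v)) ultra" .
  moreover have "((\<lambda>n. a * approx v n j) \<longlongrightarrow> a * coord j v) ultra"
    by (intro tendsto_mult tendsto_const tendsto_coord approx)
  ultimately show ?thesis by (rule tendsto_unique[OF ultra_neq_bot])
qed

lemma norm_coord_le: "norm (coord j v) \<le> norm v"
proof (rule tendsto_le[OF ultra_neq_bot])
  show "((\<lambda>n. norm (approx v n j)) \<longlongrightarrow> norm (coord j v)) ultra"
    by (intro tendsto_norm tendsto_coord approx)
  show "((\<lambda>n. norm (\<iota> (approx v n))) \<longlongrightarrow> norm v) ultra"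
    by (intro tendsto_norm tendsto_mono[OF ultra_le approx_tendsto])
  show "\<forall>\<^sub>F n in ultra. norm (approx v n j) \<le> norm (\<iota> (approx v n))"
    by (simp add: norm_embed approx_c00 coordinate_le)
qed

lemma sum_coord_le: "(\<Sum>i<n. norm (coord (n + i) v)) \<le> 2 * norm v"
proof (rule tendsto_le[OF ultra_neq_bot])
  show "((\<lambda>k. \<Sum>i<n. norm (approx v k (n + i))) \<longlongrightarrow> (\<Sum>i<n. norm (coord (n + i) v))) ultra"
    by (intro tendsto_sum tendsto_norm tendsto_coord approx)
  show "((\<lambda>n. 2 * norm (\<iota> (approx v n))) \<longlongrightarrow> 2 * norm v) ultra"
    by (intro tendsto_mult tendsto_const tendsto_norm tendsto_mono[OF ultra_le approx_tendsto])
  show "\<forall>\<^sub>F k in ultra. (\<Sum>i<n. norm (approx v k (n + i))) \<le> 2 * norm (\<iota> (approx v k))"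
    by (simp add: norm_embed approx_c00 sum_le)
qed

section \<open>Composition with an increasing index map, extended by continuity\<close>

definition reindex :: "(nat \<Rightarrow> nat) \<Rightarrow> 'v \<Rightarrow> 'v" where
  "reindex \<sigma> v = lim (\<lambda>n. \<iota> (approx v n \<circ> \<sigma>))"

context
  fixes \<sigma> :: "nat \<Rightarrow> nat"
  assumes \<sigma>: "strict_mono \<sigma>" "\<sigma> 0 = 0"
begin

lemma norm_embed_comp_diff_le:
  assumes "x \<in> c00" "y \<in> c00"
  shows "norm (\<iota> (x \<circ> \<sigma>) - \<iota> (y \<circ> \<sigma>)) \<le> norm (\<iota> x - \<iota> y)"
  using comp_le[OF diff_c00[OF assms] \<sigma>] dist_embed[OF assms]
    dist_embed[OF comp_c00[OF assms(1) \<sigma>] comp_c00[OF assms(2) \<sigma>]]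
  by (simp add: o_def)

text \<open>Composition with \<open>\<sigma>\<close> is contractive on \<open>c00\<close>, so it
  preserves Cauchy sequences, and completeness supplies the limit. Contractivity also makes the
  limit independent of the approximating sequence.\<close>

lemma tendsto_reindex:
  assumes y: "\<And>n. y n \<in> c00" "(\<lambda>n. \<iota> (y n)) \<longlonglongrightarrow> v"
  shows "(\<lambda>n. \<iota> (y n \<circ> \<sigma>)) \<longlonglongrightarrow> reindex \<sigma> v"
proof -
  have "Cauchy (\<lambda>n. \<iota> (approx v n))" using approx_tendsto by (rule LIMSEQ_imp_Cauchy)
  then have "Cauchy (\<lambda>n. \<iota> (approx v n \<circ> \<sigma>))"
    unfolding Cauchy_iff
    by (meson norm_embed_comp_diff_le[OF approx_c00 approx_c00] order_le_less_trans)
  then have lim: "(\<lambda>n. \<iota> (approx v n \<circ> \<sigma>)) \<longlonglongrightarrow> reindex \<sigma> v"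
    unfolding reindex_def by (simp add: Cauchy_convergent convergent_LIMSEQ_iff[symmetric])
  have "(\<lambda>n. \<iota> (y n) - \<iota> (approx v n)) \<longlonglongrightarrow> 0"
    using tendsto_diff[OF y(2) approx_tendsto[of v]] by simp
  from tendsto_norm_zero[OF this]
  have "(\<lambda>n. \<iota> (y n \<circ> \<sigma>) - \<iota> (approx v n \<circ> \<sigma>)) \<longlonglongrightarrow> 0"
    by (rule Lim_null_comparison[rotated])
       (intro always_eventually allI norm_embed_comp_diff_le y(1) approx_c00)
  from tendsto_add[OF this lim] show ?thesis by simp
qed

lemma reindex_embed: "x \<in> c00 \<Longrightarrow> reindex \<sigma> (\<iota> x) = \<iota> (x \<circ> \<sigma>)"
  using tendsto_reindex[of "\<lambda>_. x" "\<iota> x"] LIMSEQ_unique tendsto_const by blast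

lemma reindex_add: "reindex \<sigma> (v + w) = reindex \<sigma> v + reindex \<sigma> w"
proof -
  have "(\<lambda>n. \<iota> (\<lambda>k. approx v n k + approx w n k)) \<longlonglongrightarrow> v + w"
    using tendsto_add[OF approx_tendsto[of v] approx_tendsto[of w]]
    by (simp add: embed_add approx_c00)
  from tendsto_reindex[OF add_c00[OF approx_c00 approx_c00] this]
  have "(\<lambda>n. \<iota> (approx v n \<circ> \<sigma>) + \<iota> (approx w n \<circ> \<sigma>)) \<longlonglongrightarrow> reindex \<sigma> (v + w)"
    by (simp add: embed_add[OF comp_c00[OF approx_c00 \<sigma>] comp_c00[OF approx_c00 \<sigma>], symmetric])
       (simp add: o_def)
  moreover have "(\<lambda>n. \<iota> (approx v n \<circ> \<sigma>) + \<iota> (approx w n \<circ> \<sigma>)) \<longlonglongrightarrow> reindex \<sigma> v + reindex \<sigma> w"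
    by (intro tendsto_add tendsto_reindex approx)
  ultimately show ?thesis by (rule LIMSEQ_unique)
qed

lemma reindex_smul: "reindex \<sigma> (smul a v) = smul a (reindex \<sigma> v)"
proof -
  have "(\<lambda>n. \<iota> (\<lambda>k. a * approx v n k)) \<longlonglongrightarrow> smul a v"
    using bounded_linear.tendsto[OF bounded_linear_smul approx_tendsto[of v]]
    by (simp add: embed_scale approx_c00)
  from tendsto_reindex[OF scale_c00[OF approx_c00] this]
  have "(\<lambda>n. smul a (\<iota> (approx v n \<circ> \<sigma>))) \<longlonglongrightarrow> reindex \<sigma> (smul a v)"
    by (simp add: embed_scale[OF comp_c00[OF approx_c00 \<sigma>], symmetric]) (simp add: o_def)
  moreover have "(\<lambda>n. smul a (\<iota> (approx v n \<circ> \<sigma>))) \<longlonglongrightarrow> smul a (reindex \<sigma> v)"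
    by (intro bounded_linear.tendsto[OF bounded_linear_smul] tendsto_reindex approx)
  ultimately show ?thesis by (rule LIMSEQ_unique)
qed

lemma norm_reindex_le: "norm (reindex \<sigma> v) \<le> norm v"
proof (rule LIMSEQ_le)
  show "(\<lambda>n. norm (\<iota> (approx v n \<circ> \<sigma>))) \<longlonglongrightarrow> norm (reindex \<sigma> v)"
    by (intro tendsto_norm tendsto_reindex approx)
  show "(\<lambda>n. norm (\<iota> (approx v n))) \<longlonglongrightarrow> norm v"
    by (intro tendsto_norm approx)
  show "\<exists>n0. \<forall>n\<ge>n0. norm (\<iota> (approx v n \<circ> \<sigma>)) \<le> norm (\<iota> (approx v n))"
    by (simp add: norm_embed comp_c00[OF approx_c00 \<sigma>] approx_c00 comp_le[OF approx_c00 \<sigma>])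
qed

lemma bounded_linear_reindex: "bounded_linear (reindex \<sigma>)"
proof (rule bounded_linear_intro[where K = 1])
  show "reindex \<sigma> (r *\<^sub>R v) = r *\<^sub>R reindex \<sigma> v" for r v
    by (simp add: scale_of_real[symmetric] reindex_smul)
qed (simp_all add: reindex_add norm_reindex_le)

end

section \<open>The functionals on the operator space\<close>

text \<open>The column index is \<open>Suc n\<close> because \<open>unit_seq 0\<close> is not in \<open>c00\<close>.\<close>

definition entry :: "nat \<Rightarrow> nat \<Rightarrow> ('v \<Rightarrow>\<^sub>L 'v) \<Rightarrow> 'k" where
  "entry i n S = coord (Suc n + i) (blinfun_apply S (\<iota> (unit_seq (2 * Suc n))))"

text \<open>The functional L_i of the overview, with \<open>Suc n\<close> in place of n.\<close>

definition diag :: "nat \<Rightarrow> ('v \<Rightarrow>\<^sub>L 'v) \<Rightarrow> 'k" where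
  "diag i S = ulim (\<lambda>n. entry i n S)"

text \<open>The sum is a limit along \<open>ultra\<close> for the same reason as in \<open>coord\<close>.\<close>

definition tail :: "nat \<Rightarrow> ('v \<Rightarrow>\<^sub>L 'v) \<Rightarrow> 'k" where
  "tail m S = (if S \<in> points (operator_space smul) then ulim (\<lambda>k. \<Sum>i=m..<k. diag i S) else 0)"

lemma norm_column_le: "norm (blinfun_apply S (\<iota> (unit_seq (2 * Suc n)))) \<le> norm S"
proof -
  have "norm (\<iota> (unit_seq (2 * Suc n))) \<le> 1"
    by (subst norm_embed) (auto intro!: unit_seq_c00 unit_le)
  then show ?thesis
    using norm_blinfun[of S "\<iota> (unit_seq (2 * Suc n))"]
    by (meson mult_left_le norm_ge_zero order_trans)
qed

lemma norm_entry_le: "norm (entry i n S) \<le> norm S"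
  unfolding entry_def by (rule order_trans[OF norm_coord_le norm_column_le])

lemma sum_entry_le: "(\<Sum>i<Suc n. norm (entry i n S)) \<le> 2 * norm S"
  using sum_coord_le[of "Suc n" "blinfun_apply S (\<iota> (unit_seq (2 * Suc n)))"] norm_column_le[of S n]
  unfolding entry_def by linarith

lemma tendsto_diag: "((\<lambda>n. entry i n S) \<longlongrightarrow> diag i S) ultra"
  unfolding diag_def by (rule tendsto_ulim[OF norm_entry_le])

text \<open>For \<open>n \<ge> k\<close> the \<open>k\<close> entries all lie in the block of column
  \<open>2 * Suc n\<close> controlled by \<open>sum_entry_le\<close>. With \<open>k\<close> fixed,
  the finite sum passes to the limit.\<close>

lemma sum_diag_le: "(\<Sum>i<k. norm (diag i S)) \<le> 2 * norm S"
proof (rule tendsto_upperbound[OF _ _ ultra_neq_bot])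
  show "((\<lambda>n. \<Sum>i<k. norm (entry i n S)) \<longlongrightarrow> (\<Sum>i<k. norm (diag i S))) ultra"
    by (intro tendsto_sum tendsto_norm tendsto_diag)
  have "(\<Sum>i<k. norm (entry i n S)) \<le> 2 * norm S" if "n \<ge> k" for n
    by (rule order_trans[OF sum_mono2 sum_entry_le]) (use that in auto)
  then show "\<forall>\<^sub>F n in ultra. (\<Sum>i<k. norm (entry i n S)) \<le> 2 * norm S"
    by (intro filter_leD[OF ultra_le eventually_sequentiallyI[of k]])
qed

lemma summable_diag: "summable (\<lambda>i. norm (diag i S))"
  by (rule summableI_nonneg_bounded[OF _ sum_diag_le]) simp

text \<open>The bound is the remainder of the series of norms. It does not involve \<open>k\<close>,
  so it survives the limit in \<open>tail\<close> and makes the tails tend to 0.\<close>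

lemma norm_sum_diag_le:
  "norm (\<Sum>i=m..<k. diag i S) \<le> (\<Sum>i. norm (diag i S)) - (\<Sum>i<m. norm (diag i S))"
proof (cases "m \<le> k")
  case True
  have "norm (\<Sum>i=m..<k. diag i S) \<le> (\<Sum>i=m..<k. norm (diag i S))" by (rule norm_sum)
  also have "\<dots> = (\<Sum>i<k. norm (diag i S)) - (\<Sum>i<m. norm (diag i S))"
    using True by (simp add: sum_diff_nat_ivl lessThan_atLeast0)
  also have "\<dots> \<le> (\<Sum>i. norm (diag i S)) - (\<Sum>i<m. norm (diag i S))"
    by (intro diff_right_mono sum_le_suminf summable_diag) auto
  finally show ?thesis .
next
  case False
  then show ?thesis using sum_le_suminf[OF summable_diag, of "{..<m}" S] by simp
qed

text \<open>Uniform in \<open>m\<close> and \<open>k\<close>: partial sums are bounded, so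
  \<open>ulim\<close> acts linearly on them and \<open>tail m\<close> has norm at most 2.\<close>

lemma norm_sum_diag_le': "norm (\<Sum>i=m..<k. diag i S) \<le> 2 * norm S"
proof -
  have "(\<Sum>i. norm (diag i S)) \<le> 2 * norm S"
    by (rule suminf_le_const[OF summable_diag sum_diag_le])
  then show ?thesis
    using norm_sum_diag_le[of S m k] sum_nonneg[of "{..<m}" "\<lambda>i. norm (diag i S)"] by simp
qed

lemma operator_add_closed:
  "S \<in> points (operator_space smul) \<Longrightarrow> R \<in> points (operator_space smul) \<Longrightarrow>
    S + R \<in> points (operator_space smul)"
  by (simp add: operator_space_def blinfun.add_left scale_right_distrib)

lemma operator_smult_apply:
  "blinfun_apply (smult (operator_space smul) a S) v = smul a (blinfun_apply S v)"
proof -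
  have "bounded_linear (\<lambda>x. smul a (blinfun_apply S x))"
    by (rule bounded_linear_compose[OF bounded_linear_smul blinfun.bounded_linear_right])
  then show ?thesis by (simp add: operator_space_def bounded_linear_Blinfun_apply)
qed

lemma operator_smult_closed:
  assumes "S \<in> points (operator_space smul)"
  shows "smult (operator_space smul) a S \<in> points (operator_space smul)"
proof -
  have "blinfun_apply (smult (operator_space smul) a S) (smul b v) =
      smul b (blinfun_apply (smult (operator_space smul) a S) v)" for b v
    using assms unfolding operator_smult_apply by (simp add: operator_space_def mult.commute)
  then show ?thesis by (simp add: operator_space_def)
qed

lemma diag_add: "diag i (S + R) = diag i S + diag i R"
  unfolding diag_def
  by (subst ulim_add[OF norm_entry_le norm_entry_le, symmetric])
     (simp add: entry_def blinfun.add_left coord_add)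

lemma diag_smult: "diag i (smult (operator_space smul) a S) = a * diag i S"
  unfolding diag_def
  by (subst ulim_mult[OF norm_entry_le, symmetric])
     (simp add: entry_def operator_smult_apply coord_smul)

lemma tail_dual: "tail m \<in> points (dual (operator_space smul))"
proof (rule dualI[where K = 2])
  let ?Y = "operator_space smul"
  have add: "add ?Y = (+)" and nrm: "nrm ?Y = norm" by (simp_all add: operator_space_def)
  show "tail m (add ?Y S R) = tail m S + tail m R" if "S \<in> points ?Y" "R \<in> points ?Y" for S R
    using that
    by (simp add: tail_def add operator_add_closed diag_add sum.distrib
        ulim_add[OF norm_sum_diag_le' norm_sum_diag_le'])
  show "tail m (smult ?Y a S) = a * tail m S" if "S \<in> points ?Y" for a S
    using that
    by (simp add: tail_def operator_smult_closed diag_smult sum_distrib_left[symmetric]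
        ulim_mult[OF norm_sum_diag_le'])
  show "norm (tail m S) \<le> 2 * nrm ?Y S" if "S \<in> points ?Y" for S
    using that by (simp add: tail_def nrm norm_ulim_le[OF norm_sum_diag_le'])
qed (simp add: tail_def)

lemma tail_tendsto_0: "(\<lambda>m. tail m S) \<longlonglongrightarrow> 0"
proof (rule Lim_null_comparison[OF always_eventually])
  \<comment> \<open>Off the carrier \<open>tail m S\<close> is 0, and there the remainder being
    nonnegative suffices.\<close>
  show "\<forall>m. norm (tail m S) \<le> (\<Sum>i. norm (diag i S)) - (\<Sum>i<m. norm (diag i S))"
    using norm_ulim_le[OF norm_sum_diag_le] sum_le_suminf[OF summable_diag, of "{..<_}" S]
    by (simp add: tail_def)
  have "(\<lambda>m. (\<Sum>i. norm (diag i S)) - (\<Sum>i<m. norm (diag i S))) \<longlonglongrightarrow>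
      (\<Sum>i. norm (diag i S)) - (\<Sum>i. norm (diag i S))"
    by (intro tendsto_diff tendsto_const summable_LIMSEQ summable_diag)
  then show "(\<lambda>m. (\<Sum>i. norm (diag i S)) - (\<Sum>i<m. norm (diag i S))) \<longlonglongrightarrow> 0" by simp
qed

section \<open>The shift contractions and their diagonals\<close>

text \<open>Composition with \<open>shift M\<close> maps \<open>unit_seq (2 * n)\<close> to \<open>unit_seq (n + M)\<close> if \<open>n > M\<close>. The maximum keeps
  \<open>shift M\<close> strictly increasing on all indices, so that no coordinates have to be discarded.\<close>

definition shift :: "nat \<Rightarrow> nat \<Rightarrow> nat" where
  "shift M j = max j (2 * (j - M))"

lemma shift: "strict_mono (shift M)" "shift M 0 = 0"
  by (auto simp: shift_def strict_mono_def)

definition shift_op :: "nat \<Rightarrow> 'v \<Rightarrow>\<^sub>L 'v" where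
  "shift_op M = Blinfun (reindex (shift M))"

lemma shift_op_apply: "blinfun_apply (shift_op M) = reindex (shift M)"
  unfolding shift_op_def by (rule bounded_linear_Blinfun_apply[OF bounded_linear_reindex[OF shift]])

lemma diag_shift_op: "diag i (shift_op M) = (if i = M then 1 else 0)"
  unfolding diag_def
proof (rule ulim_eq_lim, rule tendsto_eventually, rule eventually_sequentiallyI)
  fix n assume n: "max i M \<le> n"
  \<comment> \<open>Since \<open>i \<le> n\<close>, the first argument of the maximum is below
    \<open>2 * Suc n\<close>, so equality can only come from the second; since
    \<open>M \<le> n\<close>, the subtraction there is not truncated.\<close>
  have "shift M (Suc n + i) = 2 * Suc n \<longleftrightarrow> i = M"
    using n by (auto simp: shift_def max_def split: if_splits)
  moreover have unit: "unit_seq (2 * Suc n) \<in> c00" by (rule unit_seq_c00) simp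
  ultimately show "entry i n (shift_op M) = (if i = M then 1 else 0)"
    unfolding entry_def shift_op_apply reindex_embed[OF shift unit] coord_embed[OF comp_c00[OF unit shift]]
    by (simp add: unit_seq_def del: mult_Suc_right)
qed

lemma not_grothendieck_operator_space: "\<not> grothendieck_space (operator_space smul)"
proof (rule not_grothendieck_spaceI[where f = tail and S = shift_op])
  have nrm: "nrm (operator_space smul) = norm" by (simp add: operator_space_def)
  show "0 \<le> nrm (operator_space smul) S" for S :: "'v \<Rightarrow>\<^sub>L 'v" by (simp add: nrm)
  show "nrm (operator_space smul) (shift_op M) \<le> 1" for M
    unfolding nrm by (rule norm_blinfun_bound) (simp_all add: shift_op_apply norm_reindex_le[OF shift])
  show mem: "shift_op M \<in> points (operator_space smul)" for M
    by (simp add: operator_space_def shift_op_apply reindex_smul[OF shift])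
  show "tail m (shift_op n) = 1" if "m \<le> n" for m n
  proof -
    \<comment> \<open>Only the diagonal of index \<open>n\<close> is nonzero, and
      \<open>m \<le> n < k\<close>.\<close>
    have "(\<Sum>i=m..<k. diag i (shift_op n)) = 1" if "Suc n \<le> k" for k
      using that \<open>m \<le> n\<close> by (simp add: diag_shift_op)
    then have "(\<lambda>k. \<Sum>i=m..<k. diag i (shift_op n)) \<longlonglongrightarrow> 1"
      by (intro tendsto_eventually eventually_sequentiallyI[of "Suc n"])
    then show ?thesis using mem by (simp add: tail_def ulim_eq_lim)
  qed
qed (simp_all add: tail_dual tail_tendsto_0)

end

section \<open>The Tsirelson norm\<close>

lemma successive_image:
  assumes "successive k E" "strict_mono \<sigma>" "\<sigma> 0 = (0::nat)"
  shows "successive k (\<lambda>j. \<sigma> ` E j)"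
  unfolding successive_def
proof (intro conjI ballI allI impI)
  fix j assume j: "j \<in> {1..k}"
  have "\<sigma> n \<noteq> 0" if "n \<in> E j" for n
    using that assms j strict_monoD[OF assms(2), of 0 n] by (cases "n = 0") (auto simp: successive_def)
  then show "0 \<notin> \<sigma> ` E j" by (metis imageE)
  show "finite (\<sigma> ` E j)" "\<sigma> ` E j \<noteq> {}" using assms(1) j by (auto simp: successive_def)
next
  fix j assume j: "1 \<le> j \<and> j < k"
  then have "finite (E j)" "E j \<noteq> {}" "finite (E (Suc j))" "E (Suc j) \<noteq> {}" "Max (E j) < Min (E (Suc j))"
    using assms(1) by (auto simp: successive_def)
  then show "Max (\<sigma> ` E j) < Min (\<sigma> ` E (Suc j))"
    using assms(2)
    by (simp add: mono_Max_commute[symmetric] mono_Min_commute[symmetric] strict_mono_mono strict_mono_less)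
qed

text \<open>Strictly increasing maps on the naturals satisfy \<open>n \<le> \<sigma> n\<close>, so
  moving sets to the right preserves the Schreier condition.\<close>

lemma le_Min_image:
  assumes "k \<le> Min E" "finite E" "E \<noteq> {}" "strict_mono \<sigma>"
  shows "k \<le> Min (\<sigma> ` E :: nat set)"
  using assms strict_mono_imp_increasing[OF assms(4)] by (auto intro: order_trans)

text \<open>A relation replaces a function bounding the norm because the bound of \<open>x \<circ> \<sigma>\<close> below depends on
  the coordinates of \<open>x\<close> that the composition forgets.\<close>

lemma tsirelson_norm_le_candidate:
  fixes R :: "(nat \<Rightarrow> 'k::real_normed_field) \<Rightarrow> real \<Rightarrow> bool"
  assumes sup: "\<And>z r n. R z r \<Longrightarrow> norm (z n) \<le> r"
    and c00: "\<And>z r. R z r \<Longrightarrow> z \<in> c00"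
    and sum: "\<And>z r k E. R z r \<Longrightarrow> 1 \<le> k \<Longrightarrow> successive k E \<Longrightarrow> k \<le> Min (E 1) \<Longrightarrow>
      \<exists>\<rho>. (\<forall>j\<in>{1..k}. R (restr (E j) z) (\<rho> j)) \<and> 1/2 * (\<Sum>j=1..k. \<rho> j) \<le> r"
    and R: "R z r"
  shows "tsirelson_norm z \<le> r"
  using R
proof (induction "card {n. z n \<noteq> 0}" arbitrary: z r rule: less_induct)
  case less
  let ?N = "tsirelson_norm :: (nat \<Rightarrow> 'k) \<Rightarrow> real"
  note T = is_tsirelson_norm_tsirelson_norm[where 'a = 'k]
  have N: "norm_on_c00 ?N" using T by (simp add: is_tsirelson_norm_def)
  have z: "z \<in> c00" using c00[OF less.prems] .
  have eq: "?N z = tsirelson_step ?N z"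
    using T z by (simp add: is_tsirelson_norm_def tsirelson_step_def)
  \<comment> \<open>The term \<open>1/2 * ?N z\<close> absorbs the decompositions in which one set
    contains the whole support of \<open>z\<close>; in all others every piece has smaller support
    and the induction applies.\<close>
  have "tsirelson_step ?N z \<le> max (1/2 * ?N z) r"
    unfolding tsirelson_step_le_iff[OF N z]
  proof (intro conjI ballI)
    show "(SUP n. norm (z n)) \<le> max (1/2 * ?N z) r"
      using sup[OF less.prems] by (intro cSUP_least) (auto simp: le_max_iff_disj)
    fix s assume "s \<in> tsirelson_sums ?N z"
    then obtain k E where E: "1 \<le> k" "successive k E" "k \<le> Min (E 1)"
      and s: "s = (\<Sum>j=1..k. ?N (restr (E j) z))"
      by (auto simp: tsirelson_sums_def)
    show "1/2 * s \<le> max (1/2 * ?N z) r"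
    proof (cases "\<exists>i\<in>{1..k}. {n. z n \<noteq> 0} \<subseteq> E i")
      case True
      then obtain i where i: "i \<in> {1..k}" "{n. z n \<noteq> 0} \<subseteq> E i" by blast
      have "?N (restr (E j) z) = (if j = i then ?N z else 0)" if "j \<in> {1..k}" for j
      proof (cases "j = i")
        case True
        have "restr (E i) z = z" using i by (fastforce simp: restr_def)
        then show ?thesis using True by simp
      next
        case False
        have "z n = 0" if "n \<in> E j" for n
          using successive_disjoint[OF E(2) \<open>j \<in> {1..k}\<close> i(1) False] i(2) that by blast
        then have "restr (E j) z = (\<lambda>n. 0)" by (auto simp: restr_def)
        then show ?thesis using False N zero_c00 by (auto simp: norm_on_c00_def)
      qed
      then have "s = (\<Sum>j=1..k. if j = i then ?N z else 0)" unfolding s by (intro sum.cong) auto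
      then show ?thesis using i by simp
    next
      case False
      obtain \<rho> where \<rho>: "\<And>j. j \<in> {1..k} \<Longrightarrow> R (restr (E j) z) (\<rho> j)"
        "1/2 * (\<Sum>j=1..k. \<rho> j) \<le> r"
        using sum[OF less.prems E] by blast
      have "?N (restr (E j) z) \<le> \<rho> j" if "j \<in> {1..k}" for j
      proof (rule less.hyps[OF _ \<rho>(1)[OF that]])
        have "{n. restr (E j) z n \<noteq> 0} \<subset> {n. z n \<noteq> 0}"
          using False that by (auto simp: restr_def)
        then show "card {n. restr (E j) z n \<noteq> 0} < card {n. z n \<noteq> 0}"
          using z by (intro psubset_card_mono) (auto simp: c00_def)
      qed
      then have "s \<le> (\<Sum>j=1..k. \<rho> j)" unfolding s by (rule sum_mono)
      then show ?thesis using \<rho>(2) by simp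
    qed
  qed
  \<comment> \<open>With \<open>0 \<le> r\<close>, the alternative
    \<open>?N z \<le> 1/2 * ?N z\<close> also gives the claim.\<close>
  moreover have "norm (z 0) \<le> r" using sup[OF less.prems] .
  then have "0 \<le> r" using norm_ge_zero order_trans by blast
  ultimately show ?case using eq by (auto simp: max_def split: if_splits)
qed

lemma tsirelson_norm_ge:
  fixes x :: "nat \<Rightarrow> 'k::real_normed_field"
  assumes x: "x \<in> c00"
  shows tsirelson_norm_ge_coord: "norm (x n) \<le> tsirelson_norm x"
    and tsirelson_norm_ge_sum: "1 \<le> k \<Longrightarrow> successive k E \<Longrightarrow> k \<le> Min (E 1) \<Longrightarrow>
      1/2 * (\<Sum>j=1..k. tsirelson_norm (restr (E j) x)) \<le> tsirelson_norm x"
proof -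
  note T = is_tsirelson_norm_tsirelson_norm[where 'a = 'k]
  have N: "norm_on_c00 (tsirelson_norm :: (nat \<Rightarrow> 'k) \<Rightarrow> real)" using T by (simp add: is_tsirelson_norm_def)
  have "tsirelson_step tsirelson_norm x \<le> tsirelson_norm x"
    using T x by (simp add: is_tsirelson_norm_def tsirelson_step_def)
  note le = this[unfolded tsirelson_step_le_iff[OF N x]]
  show "norm (x n) \<le> tsirelson_norm x" using le sup_norm_ge[OF x, of n] by linarith
  assume "1 \<le> k" "successive k E" "k \<le> Min (E 1)"
  then have "(\<Sum>j=1..k. tsirelson_norm (restr (E j) x)) \<in> tsirelson_sums tsirelson_norm x"
    by (auto simp: tsirelson_sums_def)
  then show "1/2 * (\<Sum>j=1..k. tsirelson_norm (restr (E j) x)) \<le> tsirelson_norm x" using le by blast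
qed

lemma tsirelson_norm_comp_le:
  fixes x :: "nat \<Rightarrow> 'k::real_normed_field"
  assumes x: "x \<in> c00" and \<sigma>: "strict_mono \<sigma>" "\<sigma> 0 = 0"
  shows "tsirelson_norm (x \<circ> \<sigma>) \<le> tsirelson_norm x"
proof (rule tsirelson_norm_le_candidate
    [where R = "\<lambda>z r. \<exists>x\<in>c00. z = x \<circ> \<sigma> \<and> r = tsirelson_norm x"])
  fix z :: "nat \<Rightarrow> 'k" and r assume "\<exists>x\<in>c00. z = x \<circ> \<sigma> \<and> r = tsirelson_norm x"
  then obtain x where x: "x \<in> c00" "z = x \<circ> \<sigma>" "r = tsirelson_norm x" by blast
  show "norm (z n) \<le> r" for n using tsirelson_norm_ge_coord[OF x(1)] x by simp
  show "z \<in> c00" using x comp_c00 \<sigma> by blast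
  fix k E assume E: "1 \<le> k" "successive k E" "k \<le> Min (E 1)"
  let ?\<rho> = "\<lambda>j. tsirelson_norm (restr (\<sigma> ` E j) x)"
  have "inj \<sigma>" using \<sigma>(1) by (rule strict_mono_imp_inj_on)
  then have "restr (E j) z = restr (\<sigma> ` E j) x \<circ> \<sigma>" for j
    by (auto simp: restr_def x inj_image_mem_iff)
  moreover have "k \<le> Min (\<sigma> ` E 1)"
    using E \<sigma> by (intro le_Min_image) (auto simp: successive_def)
  then have "1/2 * (\<Sum>j=1..k. ?\<rho> j) \<le> r"
    unfolding x by (intro tsirelson_norm_ge_sum[OF x(1)] successive_image E \<sigma>)
  ultimately show "\<exists>\<rho>. (\<forall>j\<in>{1..k}. \<exists>x\<in>c00. restr (E j) z = x \<circ> \<sigma> \<and> \<rho> j = tsirelson_norm x) \<and>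
      1/2 * (\<Sum>j=1..k. \<rho> j) \<le> r"
    using restr_c00[OF x(1)] by (intro exI[of _ ?\<rho>]) blast
qed (use x in blast)

text \<open>The candidates include all restrictions of the unit vector, to be closed under cutting.
  Disjointness lets at most one piece be nonzero.\<close>

lemma tsirelson_norm_unit_le: "tsirelson_norm (unit_seq n :: nat \<Rightarrow> 'k::real_normed_field) \<le> 1"
  if "1 \<le> n"
proof (rule tsirelson_norm_le_candidate
    [where R = "\<lambda>z r. \<exists>A. z = restr A (unit_seq n) \<and> r = (if n \<in> A then 1 else 0)"])
  fix z :: "nat \<Rightarrow> 'k" and r :: real
  assume "\<exists>A. z = restr A (unit_seq n) \<and> r = (if n \<in> A then 1 else 0)"
  then obtain A where A: "z = restr A (unit_seq n)" "r = (if n \<in> A then 1 else 0)" by blast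
  show "norm (z j) \<le> r" for j by (simp add: A restr_def unit_seq_def)
  show "z \<in> c00" unfolding A by (intro restr_c00 unit_seq_c00 that)
  fix k E assume E: "successive k E"
  let ?\<rho> = "\<lambda>j. if n \<in> E j \<inter> A then 1 else 0 :: real"
  have "1/2 * (\<Sum>j=1..k. ?\<rho> j) \<le> r"
  proof (cases "\<exists>i\<in>{1..k}. n \<in> E i \<inter> A")
    case True
    then obtain i where i: "i \<in> {1..k}" "n \<in> E i" "n \<in> A" by blast
    have "?\<rho> j = (if j = i then 1 else 0)" if "j \<in> {1..k}" for j
      using successive_disjoint[OF E that i(1)] i by auto
    then have "(\<Sum>j=1..k. ?\<rho> j) = (\<Sum>j=1..k. if j = i then 1 else 0)" by (intro sum.cong) auto
    then show ?thesis using i A by simp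
  next
    case False
    then have "(\<Sum>j=1..k. ?\<rho> j) = 0" by (intro sum.neutral) auto
    then show ?thesis by (simp add: A)
  qed
  moreover have "restr (E j) z = restr (E j \<inter> A) (unit_seq n)" for j by (auto simp: A restr_def)
  ultimately show "\<exists>\<rho>. (\<forall>j\<in>{1..k}. \<exists>A. restr (E j) z = restr A (unit_seq n) \<and>
      \<rho> j = (if n \<in> A then 1 else 0)) \<and> 1/2 * (\<Sum>j=1..k. \<rho> j) \<le> r"
    by (intro exI[of _ ?\<rho>]) auto
qed (auto intro!: exI[of _ UNIV] simp: restr_def)

lemma tsirelson_norm_sum_le:
  fixes x :: "nat \<Rightarrow> 'k::real_normed_field"
  assumes x: "x \<in> c00"
  shows "(\<Sum>i<n. norm (x (n + i))) \<le> 2 * tsirelson_norm x"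
proof (cases "n = 0")
  case True
  then show ?thesis using order_trans[OF norm_ge_zero tsirelson_norm_ge_coord[OF x]] by simp
next
  case False
  \<comment> \<open>The \<open>n\<close> singletons from \<open>{n}\<close> to
    \<open>{2 * n - 1}\<close>: exactly as many as the minimum \<open>n\<close> permits.\<close>
  let ?E = "\<lambda>j. {n + j - 1}"
  have "(\<Sum>i<n. norm (x (n + i))) = (\<Sum>j=1..n. norm (x (n + j - 1)))"
    by (rule sum.reindex_bij_witness[of _ "\<lambda>j. j - 1" Suc]) auto
  also have "\<dots> \<le> (\<Sum>j=1..n. tsirelson_norm (restr (?E j) x))"
  proof (rule sum_mono)
    show "norm (x (n + j - 1)) \<le> tsirelson_norm (restr (?E j) x)" for j
      using tsirelson_norm_ge_coord[OF restr_c00[OF x], of "?E j" "n + j - 1"] by (simp add: restr_def)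
  qed
  also have "\<dots> \<le> 2 * tsirelson_norm x"
    using tsirelson_norm_ge_sum[OF x, of n ?E] False by (auto simp: successive_def)
  finally show ?thesis .
qed

section \<open>The Baernstein norms\<close>

definition baernstein_sums :: "real \<Rightarrow> (nat \<Rightarrow> 'k::real_normed_field) \<Rightarrow> real set" where
  "baernstein_sums p x = {(\<Sum>j=1..k. mu x (A j) powr p) powr (1 / p) | k A.
       1 \<le> k \<and> successive k A \<and> (\<forall>j\<in>{1..k}. admissible (A j))}"

lemma baernstein_norm_eq_Sup: "baernstein_norm p x = Sup (baernstein_sums p x)"
  by (simp add: baernstein_norm_def baernstein_sums_def)

lemma mu_nonneg: "0 \<le> mu x A"
  by (simp add: mu_def sum_nonneg)

text \<open>The \<ell>_p-norm is at most the \<ell>_1-norm: with \<open>?B\<close> bounding the sum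
  of the terms, each term satisfies a^p \<le> a B^(p-1).\<close>

lemma baernstein_sums_le:
  fixes x :: "nat \<Rightarrow> 'k::real_normed_field"
  assumes p: "1 < p" and x: "x \<in> c00" and s: "s \<in> baernstein_sums p x"
  shows "s \<le> (\<Sum>n | x n \<noteq> 0. norm (x n))"
proof -
  let ?B = "\<Sum>n | x n \<noteq> 0. norm (x n)"
  obtain k A where A: "1 \<le> k" "successive k A"
    and s: "s = (\<Sum>j=1..k. mu x (A j) powr p) powr (1 / p)"
    using s by (auto simp: baernstein_sums_def)
  have B0: "0 \<le> ?B" by (simp add: sum_nonneg)
  have B: "(\<Sum>j=1..k. mu x (A j)) \<le> ?B"
    unfolding mu_def by (rule sum_coordinates_le[OF A(2) x]) auto
  have "mu x (A j) powr p \<le> mu x (A j) * ?B powr (p - 1)" if j: "j \<in> {1..k}" for j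
  proof -
    have "mu x (A j) \<le> (\<Sum>j=1..k. mu x (A j))"
      by (rule member_le_sum[OF j]) (auto simp: mu_nonneg)
    then have "mu x (A j) powr (p - 1) \<le> ?B powr (p - 1)"
      using B p by (intro powr_mono2) (auto simp: mu_nonneg)
    then have "mu x (A j) powr 1 * mu x (A j) powr (p - 1) \<le> mu x (A j) * ?B powr (p - 1)"
      using mu_nonneg[of x "A j"] by (simp add: mult_left_mono)
    then show ?thesis by (simp only: powr_add[symmetric]) simp
  qed
  then have "(\<Sum>j=1..k. mu x (A j) powr p) \<le> (\<Sum>j=1..k. mu x (A j) * ?B powr (p - 1))"
    by (rule sum_mono)
  also have "\<dots> \<le> ?B powr 1 * ?B powr (p - 1)"
    using B B0 by (simp add: sum_distrib_right[symmetric] mult_right_mono)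
  also have "\<dots> = ?B powr p" by (simp only: powr_add[symmetric]) simp
  finally have "s \<le> (?B powr p) powr (1 / p)"
    unfolding s using p by (intro powr_mono2) (auto intro: sum_nonneg)
  then show ?thesis using B0 p by (simp add: powr_powr)
qed

lemma baernstein_sums_bdd: "1 < p \<Longrightarrow> x \<in> c00 \<Longrightarrow> bdd_above (baernstein_sums p x)"
  using baernstein_sums_le by (intro bdd_aboveI) blast

lemma mu_in_baernstein_sums:
  assumes "1 < p" "admissible A"
  shows "mu x A \<in> baernstein_sums p x"
proof -
  have "successive 1 (\<lambda>_. A)" using assms(2) by (auto simp: successive_def admissible_def)
  moreover have "mu x A = (\<Sum>j=1..1::nat. mu x A powr p) powr (1 / p)"
    using assms(1) mu_nonneg[of x A] by (simp add: powr_powr)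
  ultimately show ?thesis
    unfolding baernstein_sums_def using assms(2)
    by (intro CollectI exI[of _ "1::nat"] exI[of _ "\<lambda>_. A"]) auto
qed

lemma mu_le_baernstein_norm:
  assumes "1 < p" "admissible A" "x \<in> c00"
  shows "mu x A \<le> baernstein_norm p x"
  unfolding baernstein_norm_eq_Sup
  by (intro cSup_upper mu_in_baernstein_sums baernstein_sums_bdd assms)

lemma admissible_singleton: "1 \<le> n \<Longrightarrow> admissible {n}"
  by (simp add: admissible_def)

lemma baernstein_sums_nonempty: "1 < p \<Longrightarrow> baernstein_sums p x \<noteq> {}"
  using mu_in_baernstein_sums[OF _ admissible_singleton[of 1]] by blast

lemma baernstein_norm_unit_le:
  assumes "1 < p" "1 \<le> n"
  shows "baernstein_norm p (unit_seq n :: nat \<Rightarrow> 'k::real_normed_field) \<le> 1"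
  unfolding baernstein_norm_eq_Sup
proof (rule cSup_least[OF baernstein_sums_nonempty[OF assms(1)]])
  fix s assume "s \<in> baernstein_sums p (unit_seq n :: nat \<Rightarrow> 'k)"
  from baernstein_sums_le[OF assms(1) unit_seq_c00[OF assms(2)] this]
  have "s \<le> (\<Sum>j | unit_seq n j \<noteq> (0::'k). norm (unit_seq n j :: 'k))" .
  moreover have "{j. unit_seq n j \<noteq> (0::'k)} = {n}" by (auto simp: unit_seq_def)
  ultimately show "s \<le> 1" by (simp add: unit_seq_def)
qed

lemma admissible_image:
  assumes "admissible A" "strict_mono \<sigma>" "\<sigma> 0 = (0::nat)"
  shows "admissible (\<sigma> ` A)"
proof -
  have "successive 1 (\<lambda>_. A)" using assms(1) by (auto simp: successive_def admissible_def)
  from successive_image[OF this assms(2,3)] have "0 \<notin> \<sigma> ` A" by (simp add: successive_def)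
  moreover have "card (\<sigma> ` A) \<le> Min (\<sigma> ` A)"
    using assms le_Min_image[of "card A" A \<sigma>]
    by (simp add: admissible_def card_image strict_mono_imp_inj_on inj_on_subset[OF strict_mono_imp_inj_on])
  ultimately show ?thesis using assms(1) by (simp add: admissible_def)
qed

lemma baernstein_norm_comp_le:
  fixes x :: "nat \<Rightarrow> 'k::real_normed_field"
  assumes p: "1 < p" and x: "x \<in> c00" and \<sigma>: "strict_mono \<sigma>" "\<sigma> 0 = 0"
  shows "baernstein_norm p (x \<circ> \<sigma>) \<le> baernstein_norm p x"
  unfolding baernstein_norm_eq_Sup
proof (rule cSup_subset_mono[OF baernstein_sums_nonempty[OF p] baernstein_sums_bdd[OF p x]])
  have mu: "mu (x \<circ> \<sigma>) A = mu x (\<sigma> ` A)" for A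
    unfolding mu_def by (subst sum.reindex[OF strict_mono_imp_inj_on[OF \<sigma>(1)]]) simp
  show "baernstein_sums p (x \<circ> \<sigma>) \<subseteq> baernstein_sums p x"
  proof
    fix s assume "s \<in> baernstein_sums p (x \<circ> \<sigma>)"
    then obtain k A where A: "1 \<le> k" "successive k A" "\<forall>j\<in>{1..k}. admissible (A j)"
      and s: "s = (\<Sum>j=1..k. mu x (\<sigma> ` A j) powr p) powr (1 / p)"
      unfolding baernstein_sums_def mu by blast
    show "s \<in> baernstein_sums p x"
      unfolding baernstein_sums_def s
      using A successive_image[OF A(2) \<sigma>] admissible_image[OF _ \<sigma>]
      by (intro CollectI exI[of _ k] exI[of _ "\<lambda>j. \<sigma> ` A j"]) auto
  qed
qed

lemma baernstein_norm_ge_coord: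
  assumes "1 < p" "x \<in> c00"
  shows "norm (x j) \<le> baernstein_norm p x"
proof (cases "j = 0")
  \<comment> \<open>\<open>{0}\<close> is not admissible, but \<open>x 0 = 0\<close> by the encoding
    of \<open>c00\<close>.\<close>
  case True
  then have "norm (x j) = 0" using assms(2) by (simp add: c00_def)
  also have "0 \<le> baernstein_norm p x"
    using mu_le_baernstein_norm[OF assms(1) admissible_singleton[of 1] assms(2)] mu_nonneg order_trans
    by blast
  finally show ?thesis .
next
  case False
  then show ?thesis
    using mu_le_baernstein_norm[OF assms(1) admissible_singleton[of j] assms(2)] by (simp add: mu_def)
qed

lemma baernstein_norm_sum_le:
  assumes p: "1 < p" and x: "x \<in> c00"
  shows "(\<Sum>i<n. norm (x (n + i))) \<le> baernstein_norm p x"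
proof (cases "n = 0")
  case True
  then show ?thesis using order_trans[OF norm_ge_zero baernstein_norm_ge_coord[OF p x]] by simp
next
  case False
  have "(\<Sum>i<n. norm (x (n + i))) = mu x {n..<n + n}"
    unfolding mu_def by (rule sum.reindex_bij_witness[of _ "\<lambda>j. j - n" "\<lambda>i. n + i"]) auto
  moreover have "admissible {n..<n + n}"
    using False by (auto simp: admissible_def)
  ultimately show ?thesis using mu_le_baernstein_norm[OF p _ x] by metis
qed

section \<open>Application to the two families of norms\<close>

theorem theorem1p1:
  fixes smul :: "'k::real_or_complex \<Rightarrow> 'v::banach \<Rightarrow> 'v"
    and p :: real
  assumes "banach_over smul"
    and "is_c00_completion tsirelson_norm smul \<or>
         (1 < p \<and> is_c00_completion (baernstein_norm p) smul)"
  shows "\<not> grothendieck_space (operator_space smul)"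
  using assms(2)
proof
  assume "is_c00_completion tsirelson_norm smul"
  then obtain \<iota> where
    "\<forall>x\<in>c00. \<forall>y\<in>c00. \<iota> (\<lambda>n. x n + y n) = \<iota> x + \<iota> y"
    "\<forall>a. \<forall>x\<in>c00. \<iota> (\<lambda>n. a * x n) = smul a (\<iota> x)"
    "\<forall>x\<in>c00. norm (\<iota> x) = tsirelson_norm x"
    "closure (\<iota> ` c00) = UNIV"
    unfolding is_c00_completion_def by blast
  then interpret sequence_completion smul tsirelson_norm \<iota>
    by (intro sequence_completion.intro[OF assms(1)] sequence_completion_axioms.intro)
       (simp_all add: tsirelson_norm_ge_coord tsirelson_norm_sum_le tsirelson_norm_unit_le
         tsirelson_norm_comp_le)
  show ?thesis by (rule not_grothendieck_operator_space)
next
  assume B: "1 < p \<and> is_c00_completion (baernstein_norm p) smul"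
  then have p: "1 < p" by simp
  obtain \<iota> where
    "\<forall>x\<in>c00. \<forall>y\<in>c00. \<iota> (\<lambda>n. x n + y n) = \<iota> x + \<iota> y"
    "\<forall>a. \<forall>x\<in>c00. \<iota> (\<lambda>n. a * x n) = smul a (\<iota> x)"
    "\<forall>x\<in>c00. norm (\<iota> x) = baernstein_norm p x"
    "closure (\<iota> ` c00) = UNIV"
    using B unfolding is_c00_completion_def by blast
  \<comment> \<open>The factor 2 of the locale stems from the 1/2 in the Tsirelson norm; here the
    block is itself admissible and the constant 1 is weakened.\<close>
  moreover have "(\<Sum>i<n. norm (x (n + i))) \<le> 2 * baernstein_norm p x"
    if "x \<in> c00" for x :: "nat \<Rightarrow> 'k" and n
    using baernstein_norm_sum_le[OF p that, of n] sum_nonneg[of "{..<n}" "\<lambda>i. norm (x (n + i))"] by simp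
  ultimately interpret sequence_completion smul "baernstein_norm p" \<iota>
    by (intro sequence_completion.intro[OF assms(1)] sequence_completion_axioms.intro)
       (simp_all add: p baernstein_norm_ge_coord baernstein_norm_unit_le baernstein_norm_comp_le)
  show ?thesis by (rule not_grothendieck_operator_space)
qed

end
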